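(* Let $m\ge1$. The Hausdorff distance (with respect to $\rho$) between $\mathcal{B}_m^{(n)}$ and $\mathcal{Y}_m$ converges to zero as $n\to\infty$: $$\lim_{n\to\infty}d_H(\mathcal{B}_m^{(n)},\mathcal{Y}_m)=0.$$
   Context: $\mathbb{T}$ is the unit circle and $dz$ denotes normalized arc length measure on it. $\mathcal{Y}_m$ is the set of all unital completely positive (ucp) linear maps $C(\mathbb{T},M_m(\mathbb{C}))\to M_m(\mathbb{C})$. Metric: $\rho(\phi,\psi)=\sup\{\|\phi(f)-\psi(f)\|_{M_m(\mathbb{C})}: f\in\mathcal{L}\}$ on $\mathcal{Y}_m$, where $\mathcal{L}=\{f\in C^1(\mathbb{T},M_m(\mathbb{C})):\|f\|_\infty\le1,\ \|f'\|_\infty\le1\}$, $\|f\|_\infty=\sup_{z\in\mathbb{T}}\|f(z)\|$ (operator norm), and $f'$ is the derivative with respect to the angular variable $\theta$, $z=e^{i\theta}$. For an isometry $V=(V_1,\ldots,V_n)^t\colon\mathbb{C}^m\to\mathbb{C}^{mn}$ (block column with $V_i\in M_m(\mathbb{C})$, $\sum_iV_i^*V_i=I_m$) put $Q_V(z)=\sum_{i=1}^nz^{n-i}V_i$. It is called regular if all its roots lie on $\mathbb{T}$, where a root is a point $a\in\mathbb{C}$ at which $Q_V(a)$ is the zero matrix. Put $\Phi_{Q_V}(f)=\int_{\mathbb{T}}Q_V(z)^*f(z)Q_V(z)\,dz$ for $f\in C(\mathbb{T},M_m(\mathbb{C}))$. For $n\in\mathbb{N}$, $\mathcal{B}_m^{(n)}=\{\Phi_{Q_V}\in\mathcal{Y}_m: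 Q_V\text{ is regular},\ \deg Q_V=n-1,\ \int_{\mathbb{T}}Q_V(z)^*Q_V(z)\,dz=I_m\}$. The Hausdorff distance between nonempty subsets $A,B$ of $\mathcal{Y}_m$ is $d_H(A,B)=\max\{\sup_{a\in A}\rho(a,B),\ \sup_{b\in B}\rho(b,A)\}$, with $\rho(a,B)=\inf_{b\in B}\rho(a,b)$. *)

theory Defs
  imports "HOL-Analysis.Analysis" "HOL-Computational_Algebra.Polynomial"
begin

type_synonym 'm cmat = "complex ^ 'm ^ 'm"

abbreviation circle :: "complex set" where
  "circle \<equiv> sphere 0 1"

definition adj :: "'m::finite cmat \<Rightarrow> 'm cmat" where
  "adj A = map_matrix cnj (transpose A)"

definition cscale :: "complex \<Rightarrow> 'm::finite cmat \<Rightarrow> 'm cmat" where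
  "cscale c A = map_matrix ((*) c) A"

definition cinner :: "complex ^ 'm::finite \<Rightarrow> complex ^ 'm \<Rightarrow> complex" where
  "cinner x y = (\<Sum>i\<in>UNIV. cnj (x $ i) * y $ i)"

text \<open>The norm of the type \<^typ>\<open>complex ^ 'm ^ 'm\<close> is the Frobenius norm, hence the following.\<close>

definition opnorm :: "'m::finite cmat \<Rightarrow> real" where
  "opnorm A = onorm (\<lambda>x. A *v x)"


text \<open>Elements of \<open>C(T, M\<^sub>m)\<close> are represented by total functions on \<^typ>\<open>complex\<close> that are
  continuous on the circle; values off the circle are irrelevant. Maps on \<open>C(T, M\<^sub>m)\<close> are
  accordingly required to depend only on the restriction of their argument to the circle, and to
  be \<^const>\<open>undefined\<close> on functions that do not represent an element of \<open>C(T, M\<^sub>m)\<close>, so that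
  they are in bijection with the maps \<open>C(T, M\<^sub>m) \<rightarrow> M\<^sub>m\<close>.\<close>

definition cont_circle :: "(complex \<Rightarrow> 'm::finite cmat) set" where
  "cont_circle = {f. continuous_on circle f}"

definition circle_map :: "((complex \<Rightarrow> 'm::finite cmat) \<Rightarrow> 'm cmat) \<Rightarrow> bool" where
  "circle_map \<phi> \<longleftrightarrow> \<phi> \<in> extensional cont_circle \<and>
     (\<forall>f\<in>cont_circle. \<forall>g\<in>cont_circle. (\<forall>z\<in>circle. f z = g z) \<longrightarrow> \<phi> f = \<phi> g)"

definition linear_map :: "((complex \<Rightarrow> 'm::finite cmat) \<Rightarrow> 'm cmat) \<Rightarrow> bool" where
  "linear_map \<phi> \<longleftrightarrow>
     (\<forall>f\<in>cont_circle. \<forall>g\<in>cont_circle. \<phi> (\<lambda>z. f z + g z) = \<phi> f + \<phi> g) \<and>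
     (\<forall>c. \<forall>f\<in>cont_circle. \<phi> (\<lambda>z. cscale c (f z)) = cscale c (\<phi> f))"

text \<open>Positive semidefiniteness of the \<open>k \<times> k\<close> block matrix with blocks \<open>A i j\<close>, \<open>i, j < k\<close>.\<close>

definition block_psd :: "nat \<Rightarrow> (nat \<Rightarrow> nat \<Rightarrow> 'm::finite cmat) \<Rightarrow> bool" where
  "block_psd k A \<longleftrightarrow>
     (\<forall>x :: nat \<Rightarrow> complex ^ 'm. (\<Sum>i<k. \<Sum>j<k. cinner (x i) (A i j *v x j)) \<in> \<real>\<^sub>\<ge>\<^sub>0)"

text \<open>Positivity in \<open>M\<^sub>k(C(T, M\<^sub>m)) = C(T, M\<^sub>k(M\<^sub>m))\<close> is pointwise positivity on the circle.\<close>

definition completely_positive :: "((complex \<Rightarrow> 'm::finite cmat) \<Rightarrow> 'm cmat) \<Rightarrow> bool" where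
  "completely_positive \<phi> \<longleftrightarrow>
     (\<forall>k. \<forall>F :: nat \<Rightarrow> nat \<Rightarrow> complex \<Rightarrow> 'm cmat.
        (\<forall>i<k. \<forall>j<k. F i j \<in> cont_circle) \<longrightarrow>
        (\<forall>z\<in>circle. block_psd k (\<lambda>i j. F i j z)) \<longrightarrow>
        block_psd k (\<lambda>i j. \<phi> (F i j)))"

definition ucp :: "((complex \<Rightarrow> 'm::finite cmat) \<Rightarrow> 'm cmat) set" where
  "ucp = {\<phi>. circle_map \<phi> \<and> linear_map \<phi> \<and> completely_positive \<phi> \<and> \<phi> (\<lambda>z. mat 1) = mat 1}"


definition sup_norm :: "(complex \<Rightarrow> 'm::finite cmat) \<Rightarrow> real" where
  "sup_norm f = (SUP z\<in>circle. opnorm (f z))"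

text \<open>The derivative with respect to the angle at \<open>z = exp(i\<theta>)\<close> is the derivative of
  \<open>t \<mapsto> f(z exp(it))\<close> at \<open>t = 0\<close>.\<close>

definition angular_deriv :: "(complex \<Rightarrow> 'm::finite cmat) \<Rightarrow> complex \<Rightarrow> 'm cmat" where
  "angular_deriv f z = vector_derivative (\<lambda>t. f (z * cis t)) (at 0)"

definition C1_circle :: "(complex \<Rightarrow> 'm::finite cmat) set" where
  "C1_circle = {f. (\<forall>z\<in>circle. (\<lambda>t::real. f (z * cis t)) differentiable (at 0)) \<and>
                   continuous_on circle (angular_deriv f)}"

definition test_functions :: "(complex \<Rightarrow> 'm::finite cmat) set" where
  "test_functions = {f \<in> C1_circle. sup_norm f \<le> 1 \<and> sup_norm (angular_deriv f) \<le> 1}"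

definition rho :: "((complex \<Rightarrow> 'm::finite cmat) \<Rightarrow> 'm cmat) \<Rightarrow> ((complex \<Rightarrow> 'm cmat) \<Rightarrow> 'm cmat) \<Rightarrow> real"
  where "rho \<phi> \<psi> = (SUP f\<in>test_functions. opnorm (\<phi> f - \<psi> f))"

definition hausdorff_dist :: "('a \<Rightarrow> 'a \<Rightarrow> real) \<Rightarrow> 'a set \<Rightarrow> 'a set \<Rightarrow> real" where
  "hausdorff_dist d A B = max (SUP a\<in>A. INF b\<in>B. d a b) (SUP b\<in>B. INF a\<in>A. d b a)"


definition circle_integral :: "(complex \<Rightarrow> 'm::finite cmat) \<Rightarrow> 'm cmat" where
  "circle_integral f = (1 / (2 * pi)) *\<^sub>R integral {0..2 * pi} (\<lambda>\<theta>. f (cis \<theta>))"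

definition block_isometry :: "nat \<Rightarrow> (nat \<Rightarrow> 'm::finite cmat) \<Rightarrow> bool" where
  "block_isometry n V \<longleftrightarrow> (\<Sum>i=1..n. adj (V i) ** V i) = mat 1"

definition Q_fun :: "nat \<Rightarrow> (nat \<Rightarrow> 'm::finite cmat) \<Rightarrow> complex \<Rightarrow> 'm cmat" where
  "Q_fun n V z = (\<Sum>i=1..n. cscale (z ^ (n - i)) (V i))"

text \<open>\<^const>\<open>Q_fun\<close> as a formal polynomial with matrix coefficients. Only the additive structure of the
  coefficients is used (the product on vectors is componentwise).\<close>

definition Q_poly :: "nat \<Rightarrow> (nat \<Rightarrow> 'm::finite cmat) \<Rightarrow> 'm cmat poly" where
  "Q_poly n V = (\<Sum>i=1..n. monom (V i) (n - i))"

definition regular :: "nat \<Rightarrow> (nat \<Rightarrow> 'm::finite cmat) \<Rightarrow> bool" where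
  "regular n V \<longleftrightarrow> (\<forall>a. Q_fun n V a = 0 \<longrightarrow> a \<in> circle)"

definition Phi :: "nat \<Rightarrow> (nat \<Rightarrow> 'm::finite cmat) \<Rightarrow> (complex \<Rightarrow> 'm cmat) \<Rightarrow> 'm cmat" where
  "Phi n V = (\<lambda>f\<in>cont_circle. circle_integral (\<lambda>z. adj (Q_fun n V z) ** f z ** Q_fun n V z))"

definition B_maps :: "nat \<Rightarrow> ((complex \<Rightarrow> 'm::finite cmat) \<Rightarrow> 'm cmat) set" where
  "B_maps n = {Phi n V | V. Phi n V \<in> ucp \<and> block_isometry n V \<and> regular n V \<and>
            degree (Q_poly n V) = n - 1 \<and>
            circle_integral (\<lambda>z. adj (Q_fun n V z) ** Q_fun n V z) = mat 1}"

end

theory Submission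
  imports Defs "HOL-Computational_Algebra.Fundamental_Theorem_Algebra"
begin

text \<open>
  Fix \<open>M\<close> and let \<open>k\<close> be the kernel \<open>((1 + Re w) / 2)\<^sup>M\<close>, normalised to mean one. Its translates to
  the roots of unity of order \<open>M + 2\<close>, divided by their number, form a partition of unity by
  trigonometric polynomials, and \<open>k\<close> has variance \<open>2 / (M + 1)\<close>. Hence a function \<open>f\<close> with \<open>\<parallel>f'\<parallel> \<le> 1\<close>
  is within \<open>O(1 / sqrt M)\<close> of the trigonometric polynomial \<open>smooth M f\<close> built from the values of \<open>f\<close> at
  these nodes (\<open>smooth_approx\<close>). As unital completely positive maps are contractive
  (\<open>ucp_contractive\<close>), it suffices to compare such maps on smoothed functions.

  By Choi's theorem (\<open>ucp_kraus\<close>), \<open>\<phi> (smooth M f)\<close> is a sum of terms \<open>K\<^sup>* f(y) K\<close>, where \<open>y\<close> runs through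
  the nodes and the number of terms depends on \<open>M\<close> and the matrix size only. Each term is imitated
  by \<open>\<integral> P\<^sup>* f P\<close> with \<open>P = p K\<close>, where \<open>p\<close> is a scalar polynomial of degree \<open>M\<close> with \<open>\<bar>p\<bar>\<^sup>2\<close> equal to the kernel at
  \<open>y\<close>. The sum of these maps is induced by one matrix polynomial: multiply the summands by
  widely separated powers of \<open>z\<close>; the cross terms then vanish exactly on trigonometric polynomials
  of degree at most \<open>M\<close> (\<open>sandwich_blocks\<close>). In particular the normalisation \<open>\<integral> Q\<^sup>* Q = 1\<close> is exact, and
  the degree is bounded independently of \<open>\<phi>\<close> (\<open>ucp_approx\<close>).

  It remains to make the polynomial regular and of degree exactly \<open>n - 1\<close>, for all large \<open>n\<close>. A root is a
  common zero of all entries, so for matrices of size at least two it is enough to add two small separated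
  blocks, a constant and a multiple of \<open>z\<^sup>n\<^sup>-\<^sup>1\<close>, chosen so that two of the entries have no common zero
  (\<open>regular_approx_matrix\<close>). A scalar polynomial \<open>q\<close> is replaced by \<open>(f + z\<^sup>k g) / sqrt 2\<close>, where
  \<open>f\<close> and \<open>g\<close> are obtained from \<open>q\<close> by reflecting its roots out of and into the disc
  (\<open>regular_approx_scalar\<close>): this has all its roots on the circle and, by separation of powers
  again, induces the same functional on trigonometric polynomials of degree at most \<open>M\<close>.
\<close>

section \<open>Operator norm and matrix algebra\<close>

lemma bounded_linear_mv_left: "bounded_linear (\<lambda>A::'m::finite cmat. A *v x)"
proof -
  have "linear (\<lambda>A::'m::finite cmat. A *v x)"
    by (rule linearI) (simp_all add: vec_eq_iff matrix_vector_mult_def algebra_simps sum.distrib scaleR_right.sum)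
  thus ?thesis by (simp add: linear_conv_bounded_linear)
qed

lemma norm_mv_le: "norm (A *v x) \<le> opnorm (A::'m::finite cmat) * norm x"
  unfolding opnorm_def by (rule onorm) simp

lemma opnorm_leI: "(\<And>x. norm (A *v x) \<le> c * norm x) \<Longrightarrow> opnorm (A::'m::finite cmat) \<le> c"
  unfolding opnorm_def by (rule onorm_le)

lemma opnorm_nonneg: "0 \<le> opnorm (A::'m::finite cmat)"
  unfolding opnorm_def by (rule onorm_pos_le) simp

lemma opnorm_0 [simp]: "opnorm (0::'m::finite cmat) = 0"
  by (intro antisym opnorm_leI opnorm_nonneg) simp

lemma opnorm_triangle: "opnorm (A + B) \<le> opnorm (A::'m::finite cmat) + opnorm B"
  unfolding opnorm_def matrix_vector_mult_add_rdistrib by (rule onorm_triangle) simp_all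


lemma adj_nth [simp]: "adj A $ i $ j = cnj (A $ j $ i)"
  by (simp add: adj_def map_matrix_def transpose_def)

lemma cscale_nth [simp]: "cscale c A $ i $ j = c * A $ i $ j"
  by (simp add: cscale_def map_matrix_def)

lemma mat_eq_iff: "A = B \<longleftrightarrow> (\<forall>i j. A $ i $ j = (B::'m::finite cmat) $ i $ j)"
  by (simp add: vec_eq_iff)

lemma mm_nth: "(A ** B) $ i $ j = (\<Sum>k\<in>UNIV. A $ i $ k * (B::'m::finite cmat) $ k $ j)"
  by (simp add: matrix_matrix_mult_def)

lemma mv_nth: "(A *v x) $ i = (\<Sum>k\<in>UNIV. (A::'m::finite cmat) $ i $ k * x $ k)"
  by (simp add: matrix_vector_mult_def)

lemma cscale_mv: "cscale c A *v x = c *s (A *v x)"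
  by (simp add: vec_eq_iff mv_nth sum_distrib_left mult_ac)

lemma norm_cmult_vec: "norm (c *s (x::complex^'m::finite)) = norm c * norm x"
  by (simp add: norm_vec_def L2_set_def norm_mult power_mult_distrib real_sqrt_mult
      flip: sum_distrib_left)

lemma opnorm_cscale_le: "opnorm (cscale c A) \<le> norm c * opnorm A"
  by (rule opnorm_leI)
     (metis cscale_mv mult.assoc mult_left_mono norm_cmult_vec norm_ge_zero norm_mv_le)

lemma opnorm_minus: "opnorm (A - B) = opnorm (B - (A::'m::finite cmat))"
  unfolding opnorm_def matrix_vector_mult_diff_rdistrib
  by (subst onorm_neg[symmetric]) simp

lemma opnorm_sum_le: "opnorm (\<Sum>i\<in>I. A i) \<le> (\<Sum>i\<in>I. opnorm (A i :: 'm::finite cmat))"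
proof (induction I rule: infinite_finite_induct)
  case (insert x F)
  thus ?case using opnorm_triangle[of "A x" "\<Sum>i\<in>F. A i"] by simp
qed simp_all

text \<open>Together with \<open>opnorm_le_norm\<close> below this makes the operator norm and the norm of the matrix type
  equivalent, so continuity on the circle can be checked in either.\<close>

lemma norm_nth_nth_le_opnorm: "norm (A $ i $ j) \<le> opnorm (A::'m::finite cmat)"
proof -
  have "norm (axis j (1::complex)) = 1"
    by (simp add: norm_vec_def L2_set_def axis_def if_distrib if_distribR cong: if_cong)
  have "norm (A $ i $ j) = norm ((A *v axis j 1) $ i)"
    by (simp add: mv_nth axis_def if_distrib cong: if_cong)
  also have "\<dots> \<le> norm (A *v axis j 1)" by (rule Finite_Cartesian_Product.norm_nth_le)
  also have "\<dots> \<le> opnorm A * norm (axis j (1::complex))" by (rule norm_mv_le)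
  finally show ?thesis using \<open>norm (axis j (1::complex)) = 1\<close> by simp
qed

lemma cinner_scale_left: "cinner (c *s x) y = cnj c * cinner x y"
  and cinner_scale_right: "cinner x (c *s y) = c * cinner x y"
  by (simp_all add: cinner_def mult_ac sum_distrib_left)

lemma cinner_self: "cinner x x = of_real ((norm x)\<^sup>2)"
  by (simp add: cinner_def norm_vec_def L2_set_def real_sqrt_pow2 sum_nonneg mult.commute
      flip: complex_norm_square)

lemma norm_cinner_le: "norm (cinner x y) \<le> norm x * norm y"
proof -
  have "norm (cinner x y) \<le> (\<Sum>i\<in>UNIV. \<bar>norm (x $ i)\<bar> * \<bar>norm (y $ i)\<bar>)"
    unfolding cinner_def by (rule order_trans[OF norm_sum]) (simp add: norm_mult)
  also have "\<dots> \<le> norm x * norm y"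
    unfolding norm_vec_def by (rule L2_set_mult_ineq)
  finally show ?thesis .
qed

lemma cinner_adj_mv: "cinner x (adj A *v y) = cinner (A *v x) y"
proof -
  have "cinner x (adj A *v y) = (\<Sum>i\<in>UNIV. \<Sum>k\<in>UNIV. cnj (x $ i) * cnj (A $ k $ i) * y $ k)"
    by (simp add: cinner_def mv_nth sum_distrib_left mult_ac)
  also have "\<dots> = (\<Sum>k\<in>UNIV. \<Sum>i\<in>UNIV. cnj (x $ i) * cnj (A $ k $ i) * y $ k)"
    by (rule sum.swap)
  also have "\<dots> = cinner (A *v x) y"
    by (simp add: cinner_def mv_nth sum_distrib_right sum_distrib_left mult_ac)
  finally show ?thesis .
qed

lemma cinner_cnj: "cnj (cinner x y) = cinner y x"
  by (simp add: cinner_def mult.commute)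

lemma sum_mm_left: "(\<Sum>i\<in>I. A i :: 'm::finite cmat) ** (B :: 'm cmat) = (\<Sum>i\<in>I. A i ** B)"
  by (simp add: mat_eq_iff mm_nth sum_distrib_right sum.swap[of _ I])

lemma sum_mm_right: "B ** (\<Sum>i\<in>I. A i) = (\<Sum>i\<in>I. B ** (A i::'m::finite cmat))"
  by (induction I rule: infinite_finite_induct) (simp_all add: matrix_add_ldistrib)

lemma adj_sum: "adj (\<Sum>i\<in>I. A i) = (\<Sum>i\<in>I. adj (A i))"
  by (simp add: mat_eq_iff)

lemma adj_cscale: "adj (cscale c A) = cscale (cnj c) (adj A)"
  by (simp add: mat_eq_iff)

lemma cscale_mm_left: "cscale c A ** B = cscale c (A ** B)"
  and cscale_mm_right: "A ** cscale c B = cscale c (A ** B)"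
  by (simp_all add: mat_eq_iff mm_nth sum_distrib_left mult_ac)

lemma cscale_cscale: "cscale a (cscale b A) = cscale (a * b) A"
  by (simp add: mat_eq_iff mult_ac)

lemma cscale_1 [simp]: "cscale 1 A = A"
  and cscale_0 [simp]: "cscale 0 A = 0"
  by (simp_all add: mat_eq_iff)

lemma cscale_add: "cscale c (A + B) = cscale c A + cscale c B"
  and cscale_diff: "cscale c (A - B) = cscale c A - cscale c B"
  by (simp_all add: mat_eq_iff algebra_simps)

lemma cscale_of_real: "cscale (of_real r) A = r *\<^sub>R A"
  by (simp add: mat_eq_iff) (simp add: scaleR_conv_of_real)

lemma cscale_sum: "cscale c (\<Sum>i\<in>I. A i) = (\<Sum>i\<in>I. cscale c (A i))"
  and cscale_sum_left: "cscale (\<Sum>i\<in>I. a i) B = (\<Sum>i\<in>I. cscale (a i) B)"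
  by (simp_all add: mat_eq_iff sum_distrib_left sum_distrib_right)

section \<open>Averages over the circle\<close>

definition cmean :: "(complex \<Rightarrow> 'a::euclidean_space) \<Rightarrow> 'a" where
  "cmean f = (1 / (2 * pi)) *\<^sub>R integral {0..2 * pi} (\<lambda>\<theta>. f (cis \<theta>))"

lemma circle_integral_eq_cmean: "circle_integral f = cmean f"
  by (simp add: circle_integral_def cmean_def)

lemma cmean_cong: "(\<And>z. z \<in> circle \<Longrightarrow> f z = g z) \<Longrightarrow> cmean f = cmean g"
  by (simp add: cmean_def)

lemma cis_integrable:
  assumes "continuous_on circle f"
  shows "(\<lambda>\<theta>. f (cis \<theta>) :: 'a::euclidean_space) integrable_on {a..b}"
  by (rule integrable_continuous_real, rule continuous_on_compose2[OF assms])
     (auto intro: continuous_intros)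

lemma cmean_linear:
  assumes "bounded_linear L" "continuous_on circle f"
  shows "cmean (\<lambda>z. L (f z)) = L (cmean f)"
proof -
  interpret L: bounded_linear L by fact
  show ?thesis
    using integral_linear[OF cis_integrable[OF assms(2), of 0 "2 * pi"] assms(1)]
    by (simp add: cmean_def o_def L.scaleR)
qed

lemma cmean_add:
  "continuous_on circle f \<Longrightarrow> continuous_on circle g \<Longrightarrow> cmean (\<lambda>z. f z + g z) = cmean f + cmean g"
  by (simp add: cmean_def integral_add cis_integrable scaleR_add_right)

lemma cmean_diff:
  "continuous_on circle f \<Longrightarrow> continuous_on circle g \<Longrightarrow> cmean (\<lambda>z. f z - g z) = cmean f - cmean g"
  by (simp add: cmean_def integral_diff cis_integrable scaleR_diff_right)

lemma cmean_sum:
  assumes "finite I" "\<And>i. i \<in> I \<Longrightarrow> continuous_on circle (f i)"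
  shows "cmean (\<lambda>z. \<Sum>i\<in>I. f i z) = (\<Sum>i\<in>I. cmean (f i))"
  using assms
  by (induction I rule: finite_induct)
     (simp_all add: cmean_def[of "\<lambda>z. 0"] cmean_add continuous_on_sum)

lemma cmean_const [simp]: "cmean (\<lambda>z. c) = c"
  by (simp add: cmean_def)

lemma cmean_mult_left: "continuous_on circle f \<Longrightarrow> cmean (\<lambda>z. c * f z) = c * cmean (f :: _ \<Rightarrow> complex)"
  by (rule cmean_linear[OF bounded_linear_mult_right])

lemma norm_cmean_le:
  assumes "continuous_on circle f" "continuous_on circle g"
    and "\<And>z. z \<in> circle \<Longrightarrow> norm (f z) \<le> g z"
  shows "norm (cmean f) \<le> cmean g"
proof -
  have "norm (integral {0..2 * pi} (\<lambda>\<theta>. f (cis \<theta>))) \<le> integral {0..2 * pi} (\<lambda>\<theta>. g (cis \<theta>))"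
    using assms by (intro integral_norm_bound_integral cis_integrable) auto
  thus ?thesis by (simp add: cmean_def divide_right_mono)
qed

lemma cmean_power:
  fixes k :: int
  shows "cmean (\<lambda>z. z powi k) = (if k = 0 then 1 else 0)"
proof (cases "k = 0")
  case False
  have "((\<lambda>\<theta>. cis \<theta> powi k) has_integral
      (cis (k * (2*pi :: real)) / (\<i> * k) - cis (k * (0::real)) / (\<i> * k))) {0..2*pi}"
  proof (rule fundamental_theorem_of_calculus)
    fix x assume "x \<in> {0..2*pi}"
    show "((\<lambda>x. cis (k * x) / (\<i> * k)) has_vector_derivative cis x powi k) (at x within {0..2 * pi})"
    proof -
      have "((\<lambda>z. exp (\<i> * k * z) / (\<i> * k)) has_field_derivative exp (\<i> * k * of_real x)) (at (of_real x))"
        by (rule derivative_eq_intros refl | simp add: False)+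
      from has_vector_derivative_real_field[OF this] show ?thesis
        unfolding cis_power_int unfolding cis_conv_exp by (simp add: mult_ac)
    qed
  qed simp
  moreover have "cis (k * (2*pi)) = 1"
    by (metis cis_multiple_2pi Ints_of_int mult.commute)
  ultimately have "integral {0..2 * pi} (\<lambda>\<theta>. cis \<theta> powi k) = 0"
    by (simp add: integral_unique)
  thus ?thesis using False by (simp add: cmean_def)
qed simp

section \<open>Unital completely positive maps\<close>

lemma continuous_on_matI:
  assumes "\<And>i j. continuous_on S (\<lambda>z. f z $ i $ j)"
  shows "continuous_on S (f :: _ \<Rightarrow> 'm::finite cmat)"
proof -
  have "continuous_on S (\<lambda>z. \<chi> i j. f z $ i $ j)"
    by (intro continuous_on_vec_lambda assms)
  thus ?thesis by simp
qed

lemma continuous_on_nth_nth: "continuous_on S f \<Longrightarrow> continuous_on S (\<lambda>z. f z $ i $ (j::'m::finite))"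
  by (intro continuous_on_component)

lemma continuous_on_mm [continuous_intros]:
  "continuous_on S f \<Longrightarrow> continuous_on S g \<Longrightarrow> continuous_on S (\<lambda>z. (f z :: 'm::finite cmat) ** (g z :: 'm::finite cmat))"
  by (intro continuous_on_matI, unfold mm_nth, intro continuous_intros continuous_on_nth_nth)

lemma continuous_on_adj [continuous_intros]:
  "continuous_on S f \<Longrightarrow> continuous_on S (\<lambda>z. adj (f z :: 'm::finite cmat))"
  by (intro continuous_on_matI, unfold adj_nth, intro continuous_intros continuous_on_nth_nth)

lemma continuous_on_cscale [continuous_intros]:
  "continuous_on S f \<Longrightarrow> continuous_on S g \<Longrightarrow> continuous_on S (\<lambda>z. cscale (f z) (g z :: 'm::finite cmat))"
  by (intro continuous_on_matI, unfold cscale_nth, intro continuous_intros continuous_on_nth_nth)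

lemma ucp_add: "\<phi> \<in> ucp \<Longrightarrow> continuous_on circle f \<Longrightarrow> continuous_on circle g \<Longrightarrow> \<phi> (\<lambda>z. f z + g z) = \<phi> f + \<phi> g"
  by (auto simp: ucp_def linear_map_def cont_circle_def)

lemma ucp_cscale: "\<phi> \<in> ucp \<Longrightarrow> continuous_on circle f \<Longrightarrow> \<phi> (\<lambda>z. cscale c (f z)) = cscale c (\<phi> f)"
  by (auto simp: ucp_def linear_map_def cont_circle_def)

lemma ucp_one: "\<phi> \<in> ucp \<Longrightarrow> \<phi> (\<lambda>z. mat 1) = mat 1"
  by (auto simp: ucp_def)

lemma ucp_cong:
  "\<phi> \<in> ucp \<Longrightarrow> continuous_on circle f \<Longrightarrow> continuous_on circle g \<Longrightarrow> (\<And>z. z \<in> circle \<Longrightarrow> f z = g z) \<Longrightarrow> \<phi> f = \<phi> g"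
  unfolding ucp_def circle_map_def cont_circle_def mem_Collect_eq by blast

lemma ucp_zero: "\<phi> \<in> ucp \<Longrightarrow> \<phi> (\<lambda>z. 0) = 0"
  using ucp_cscale[of \<phi> "\<lambda>z. 0" 0] by simp

lemma ucp_sum:
  assumes "\<phi> \<in> ucp" "\<And>i. i \<in> I \<Longrightarrow> continuous_on circle (f i)"
  shows "\<phi> (\<lambda>z. \<Sum>i\<in>I. f i z) = (\<Sum>i\<in>I. \<phi> (f i))"
  using assms(2)
  by (induction I rule: infinite_finite_induct)
     (simp_all add: ucp_zero[OF assms(1)] ucp_add[OF assms(1)] continuous_on_sum)

lemma ucp_diff:
  assumes "\<phi> \<in> ucp" "continuous_on circle f" "continuous_on circle g"
  shows "\<phi> (\<lambda>z. f z - g z) = \<phi> f - \<phi> g"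
  using ucp_add[OF assms(1), of "\<lambda>z. f z - g z" g] assms by (simp add: continuous_on_diff)

lemma ucp_block_psd:
  assumes "\<phi> \<in> ucp" "\<And>i j. i < k \<Longrightarrow> j < k \<Longrightarrow> continuous_on circle (F i j)"
    and "\<And>z. z \<in> circle \<Longrightarrow> block_psd k (\<lambda>i j. F i j z)"
  shows "block_psd k (\<lambda>i j. \<phi> (F i j))"
proof -
  have "completely_positive \<phi>" using assms(1) by (simp add: ucp_def)
  moreover have "\<forall>i<k. \<forall>j<k. F i j \<in> cont_circle" using assms(2) by (simp add: cont_circle_def)
  ultimately show ?thesis using assms(3) unfolding completely_positive_def by blast
qed

text \<open>If \<open>\<parallel>f\<parallel> \<le> d\<close> then the two by two block function with diagonal \<open>d, d\<close> and off-diagonal entries \<open>f, f\<^sup>*\<close>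
  is pointwise positive. Applying \<open>\<phi>\<close> to the blocks leaves the diagonal unchanged, and a positive
  block matrix with diagonal \<open>d, d\<close> has a corner of norm at most \<open>d\<close>.\<close>

lemma ucp_contractive:
  assumes \<phi>: "\<phi> \<in> ucp" and f: "continuous_on circle f" and d: "d > 0"
    and le: "\<And>z. z \<in> circle \<Longrightarrow> opnorm (f z) \<le> d"
  shows "opnorm (\<phi> f) \<le> d"
proof (rule opnorm_leI)
  fix y
  define F where "F i j = (if i = j then (\<lambda>z. cscale (of_real d) (mat 1)) else
     if i < j then f else (\<lambda>z. adj (f z)))" for i j :: nat
  have F: "continuous_on circle (F i j)" for i j
    by (auto simp: F_def intro!: continuous_intros f)
  have pt: "block_psd 2 (\<lambda>i j. F i j z)" if z: "z \<in> circle" for z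
    unfolding block_psd_def
  proof
    fix x :: "nat \<Rightarrow> complex ^ 'a"
    let ?a = "cinner (x 0) (f z *v x 1)"
    have "(\<Sum>i<2. \<Sum>j<2. cinner (x i) (F i j z *v x j)) =
       of_real d * of_real ((norm (x 0))\<^sup>2) + ?a + (cnj ?a + of_real d * of_real ((norm (x 1))\<^sup>2))"
      by (simp add: F_def numeral_2_eq_2 cscale_mv cinner_scale_right cinner_self cinner_adj_mv cinner_cnj)
    also have "\<dots> = of_real (d * (norm (x 0))\<^sup>2 + d * (norm (x 1))\<^sup>2 + 2 * Re ?a)"
      using complex_add_cnj[of ?a] by (simp add: algebra_simps)
    also have "\<dots> \<in> \<real>\<^sub>\<ge>\<^sub>0"
    proof -
      have "\<bar>Re ?a\<bar> \<le> norm (x 0) * norm (f z *v x 1)"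
        using norm_cinner_le abs_Re_le_cmod order_trans by blast
      also have "\<dots> \<le> norm (x 0) * (d * norm (x 1))"
        using norm_mv_le[of "f z" "x 1"] le[OF z]
        by (meson mult_left_mono mult_right_mono norm_ge_zero order_trans)
      finally have "\<bar>2 * Re ?a\<bar> \<le> d * (2 * norm (x 0) * norm (x 1))" by (simp add: mult_ac)
      also have "\<dots> \<le> d * ((norm (x 0))\<^sup>2 + (norm (x 1))\<^sup>2)"
        using d sum_squares_bound[of "norm (x 0)" "norm (x 1)"] by (intro mult_left_mono) auto
      finally have "0 \<le> d * (norm (x 0))\<^sup>2 + d * (norm (x 1))\<^sup>2 + 2 * Re ?a"
        by (simp add: algebra_simps)
      thus ?thesis by (simp only: nonneg_Reals_of_real_iff)
    qed
    finally show "(\<Sum>i<2. \<Sum>j<2. cinner (x i) (F i j z *v x j)) \<in> \<real>\<^sub>\<ge>\<^sub>0" .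
  qed
  have psd: "block_psd 2 (\<lambda>i j. \<phi> (F i j))"
    by (rule ucp_block_psd[OF \<phi> F pt])
  define w where "w = \<phi> f *v y"
  define A where "A = \<phi> (\<lambda>z. adj (f z))"
  have d1: "\<phi> (\<lambda>z. cscale (of_real d) (mat 1)) = cscale (of_real d) (mat 1)"
    using ucp_cscale[OF \<phi>, of "\<lambda>z. mat 1" "of_real d"] by (simp add: ucp_one[OF \<phi>])
  have *: "of_real d * of_real ((norm u)\<^sup>2) + cinner u w + (cinner y (A *v u) + of_real d * of_real ((norm y)\<^sup>2)) \<in> \<real>\<^sub>\<ge>\<^sub>0" for u
    using psd[unfolded block_psd_def, rule_format, of "\<lambda>i. if i = 0 then u else y"]
    by (simp add: F_def numeral_2_eq_2 d1 A_def w_def cscale_mv cinner_scale_right cinner_self)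
  define b where "b = cinner y (A *v w)"
  have sc: "A *v (c *s u) = c *s (A *v u)" for c u by (simp add: vec_eq_iff mv_nth sum_distrib_left mult_ac)
  \<comment> \<open>Testing positivity at \<open>u = w\<close> and \<open>u = \<i> w\<close> shows \<open>b = \<langle>w, w\<rangle>\<close>, that is, \<open>A\<close> behaves as the adjoint of
    \<open>\<phi> f\<close>; the bound then comes from \<open>u = - w / d\<close>, which minimises the quadratic form in \<open>u\<close>.\<close>
  have "Im b = 0" using *[of w] by (auto simp: b_def complex_nonneg_Reals_iff cinner_self)
  have "Re b = (norm w)\<^sup>2" using *[of "\<i> *s w"]
    by (auto simp: b_def complex_nonneg_Reals_iff sc cinner_scale_left cinner_scale_right cinner_self norm_cmult_vec)
  have "0 \<le> d * (t * norm w)\<^sup>2 + t * (norm w)\<^sup>2 + (t * (norm w)\<^sup>2 + d * (norm y)\<^sup>2)" for t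
    using *[of "of_real t *s w"] \<open>Re b = _\<close>
    by (simp add: b_def complex_nonneg_Reals_iff sc cinner_scale_left cinner_scale_right cinner_self norm_cmult_vec power_mult_distrib)
  from this[of "- 1 / d"] have "0 \<le> d * (norm w / d)\<^sup>2 - (norm w)\<^sup>2 / d + (- (norm w)\<^sup>2 / d + d * (norm y)\<^sup>2)"
    by simp
  hence "(norm w)\<^sup>2 / d \<le> d * (norm y)\<^sup>2"
    using d by (simp add: power_divide power2_eq_square field_simps)
  hence "(norm w)\<^sup>2 \<le> (d * norm y)\<^sup>2"
    using d by (simp add: divide_le_eq power_mult_distrib power2_eq_square mult_ac)
  thus "norm (\<phi> f *v y) \<le> d * norm y"
    unfolding w_def by (rule power2_le_imp_le) (use d in simp)
qed

section \<open>The maps induced by matrix polynomials\<close>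

text \<open>The map \<open>f \<mapsto> \<integral> Q\<^sup>* f Q\<close>, defined for every \<open>Q\<close> on the circle, so that it can be computed for
  the blocks of which the final matrix polynomial is composed.\<close>

definition sandwich :: "(complex \<Rightarrow> 'm::finite cmat) \<Rightarrow> (complex \<Rightarrow> 'm cmat) \<Rightarrow> 'm cmat" where
  "sandwich P G = cmean (\<lambda>z. adj (P z) ** G z ** P z)"

lemma continuous_on_Q_fun [continuous_intros]: "continuous_on S (Q_fun n V)"
  unfolding Q_fun_def by (intro continuous_intros)

lemma Phi_eq_sandwich: "continuous_on circle f \<Longrightarrow> Phi n V f = sandwich (Q_fun n V) f"
  by (simp add: Phi_def cont_circle_def sandwich_def circle_integral_eq_cmean)

lemma mm_add_left: "((A :: 'm::finite cmat) + B) ** C = A ** C + B ** (C :: 'm cmat)"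
  by (simp add: mat_eq_iff mm_nth algebra_simps sum.distrib)

lemma sandwich_add:
  "continuous_on circle P \<Longrightarrow> continuous_on circle f \<Longrightarrow> continuous_on circle g \<Longrightarrow>
   sandwich P (\<lambda>z. f z + g z) = sandwich P f + sandwich P g"
  unfolding sandwich_def matrix_add_ldistrib mm_add_left by (intro cmean_add continuous_intros)

lemma bounded_linear_cscale: "bounded_linear (cscale c :: 'm::finite cmat \<Rightarrow> _)"
proof -
  have "linear (cscale c :: 'm::finite cmat \<Rightarrow> _)"
    by (rule linearI) (simp_all add: cscale_add mat_eq_iff)
  thus ?thesis by (simp add: linear_conv_bounded_linear)
qed

lemma sandwich_cscale:
  assumes "continuous_on circle P" "continuous_on circle f"
  shows "sandwich P (\<lambda>z. cscale c (f z)) = cscale c (sandwich P f)"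
  unfolding sandwich_def cscale_mm_left cscale_mm_right
  by (intro cmean_linear bounded_linear_cscale continuous_intros assms)

lemma bounded_linear_cinner_mv: "bounded_linear (\<lambda>A::'m::finite cmat. cinner x (A *v y))"
proof -
  have "linear (cinner x)"
    by (rule linearI) (simp_all add: cinner_def algebra_simps sum.distrib scaleR_right.sum)
  hence "bounded_linear (cinner x)" by (simp add: linear_conv_bounded_linear)
  from bounded_linear_compose[OF this bounded_linear_mv_left] show ?thesis .
qed

lemma cmean_mono:
  fixes f g :: "complex \<Rightarrow> real"
  assumes "continuous_on circle f" "continuous_on circle g" "\<And>z. z \<in> circle \<Longrightarrow> f z \<le> g z"
  shows "cmean f \<le> cmean g"
  unfolding cmean_def
  by (intro scaleR_left_mono integral_le cis_integrable) (use assms in auto)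

lemma cmean_nonneg_Reals:
  fixes f :: "complex \<Rightarrow> complex"
  assumes f: "continuous_on circle f" and nn: "\<And>z. z \<in> circle \<Longrightarrow> f z \<in> \<real>\<^sub>\<ge>\<^sub>0"
  shows "cmean f \<in> \<real>\<^sub>\<ge>\<^sub>0"
proof -
  have "cmean f = cmean (\<lambda>z. complex_of_real (Re (f z)))"
    by (rule cmean_cong) (use nn in \<open>auto simp: complex_nonneg_Reals_iff complex_eq_iff\<close>)
  also have "\<dots> = of_real (cmean (\<lambda>z. Re (f z)))"
    by (intro cmean_linear[OF bounded_linear_of_real] continuous_intros f)
  finally have eq: "cmean f = of_real (cmean (\<lambda>z. Re (f z)))" .
  have "cmean (\<lambda>z. 0) \<le> cmean (\<lambda>z. Re (f z))"
    by (rule cmean_mono) (use nn in \<open>auto intro!: continuous_intros f simp: complex_nonneg_Reals_iff\<close>)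
  thus ?thesis unfolding eq by simp
qed

text \<open>Complete positivity is inherited pointwise: \<open>\<langle>x\<^sub>i, Q\<^sup>* F\<^sub>i\<^sub>j Q x\<^sub>j\<rangle> = \<langle>Q x\<^sub>i, F\<^sub>i\<^sub>j Q x\<^sub>j\<rangle>\<close>, and the average of a
  nonnegative function is nonnegative.\<close>

lemma Phi_ucp:
  assumes "sandwich (Q_fun n V) (\<lambda>z. mat 1) = (mat 1 :: 'm::finite cmat)"
  shows "Phi n V \<in> ucp"
proof -
  let ?Q = "Q_fun n V"
  have Q: "continuous_on circle ?Q" by (rule continuous_on_Q_fun)
  have "circle_map (Phi n V)"
    unfolding circle_map_def
  proof (intro conjI ballI impI)
    show "Phi n V \<in> extensional cont_circle" by (simp add: Phi_def)
  next
    fix f g :: "complex \<Rightarrow> 'm cmat" assume "f \<in> cont_circle" "g \<in> cont_circle" "\<forall>z\<in>circle. f z = g z"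
    thus "Phi n V f = Phi n V g"
      by (auto simp: Phi_eq_sandwich cont_circle_def sandwich_def intro!: cmean_cong)
  qed
  moreover have "linear_map (Phi n V)"
    by (auto simp: linear_map_def cont_circle_def Phi_eq_sandwich continuous_intros sandwich_add[OF Q] sandwich_cscale[OF Q])
  moreover have "completely_positive (Phi n V)"
    unfolding completely_positive_def
  proof (intro allI impI)
    fix k and F :: "nat \<Rightarrow> nat \<Rightarrow> complex \<Rightarrow> 'm cmat"
    assume F: "\<forall>i<k. \<forall>j<k. F i j \<in> cont_circle" and psd: "\<forall>z\<in>circle. block_psd k (\<lambda>i j. F i j z)"
    have Fc: "continuous_on circle (F i j)" if "i < k" "j < k" for i j
      using F that by (simp add: cont_circle_def)
    show "block_psd k (\<lambda>i j. Phi n V (F i j))"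
      unfolding block_psd_def
    proof
      fix x :: "nat \<Rightarrow> complex ^ 'm"
      let ?g = "\<lambda>i j z. cinner (x i) ((adj (?Q z) ** F i j z ** ?Q z) *v x j)"
      have gc: "continuous_on circle (?g i j)" if "i < k" "j < k" for i j
        by (intro bounded_linear.continuous_on[OF bounded_linear_cinner_mv] continuous_intros Fc that)
      have "(\<Sum>i<k. \<Sum>j<k. cinner (x i) (Phi n V (F i j) *v x j)) = (\<Sum>i<k. \<Sum>j<k. cmean (?g i j))"
      proof (intro sum.cong refl)
        fix i j assume "i \<in> {..<k}" "j \<in> {..<k}"
        hence c: "continuous_on circle (F i j)" by (simp add: Fc)
        show "cinner (x i) (Phi n V (F i j) *v x j) = cmean (?g i j)"
          unfolding Phi_eq_sandwich[OF c] sandwich_def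
          by (rule cmean_linear[symmetric, OF bounded_linear_cinner_mv]) (intro continuous_intros c)
      qed
      also have "\<dots> = cmean (\<lambda>z. \<Sum>i<k. \<Sum>j<k. ?g i j z)"
        by (subst cmean_sum, simp, (intro continuous_intros gc; simp), intro sum.cong refl, subst cmean_sum)
           (auto intro!: gc)
      also have "\<dots> \<in> \<real>\<^sub>\<ge>\<^sub>0"
      proof (rule cmean_nonneg_Reals)
        show "continuous_on circle (\<lambda>z. \<Sum>i<k. \<Sum>j<k. ?g i j z)"
          by (intro continuous_intros gc) auto
      next
        fix z :: complex assume "z \<in> circle"
        hence "(\<Sum>i<k. \<Sum>j<k. cinner (?Q z *v x i) (F i j z *v (?Q z *v x j))) \<in> \<real>\<^sub>\<ge>\<^sub>0"
          using psd by (auto simp: block_psd_def dest!: bspec spec[of _ "\<lambda>i. ?Q z *v x i"])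
        thus "(\<Sum>i<k. \<Sum>j<k. ?g i j z) \<in> \<real>\<^sub>\<ge>\<^sub>0"
          by (simp add: cinner_adj_mv flip: matrix_vector_mul_assoc)
      qed
      finally show "(\<Sum>i<k. \<Sum>j<k. cinner (x i) (Phi n V (F i j) *v x j)) \<in> \<real>\<^sub>\<ge>\<^sub>0" .
    qed
  qed
  ultimately show ?thesis using assms
    by (simp add: ucp_def Phi_eq_sandwich)
qed

section \<open>Trigonometric polynomials\<close>

text \<open>Only the values on the circle count, whence the last rule: it allows \<open>cnj z\<close> to be replaced by
  \<open>inverse z\<close>. The inductive form avoids bookkeeping with coefficient families; all that is needed
  later is that a trigonometric polynomial of degree at most \<open>M\<close> is orthogonal to the powers of \<open>z\<close>
  with exponent beyond \<open>M\<close> in absolute value.\<close>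

inductive trig_poly :: "nat \<Rightarrow> (complex \<Rightarrow> complex) \<Rightarrow> bool" for M where
  monom: "\<bar>k\<bar> \<le> int M \<Longrightarrow> trig_poly M (\<lambda>z. z powi k)"
| add: "trig_poly M f \<Longrightarrow> trig_poly M g \<Longrightarrow> trig_poly M (\<lambda>z. f z + g z)"
| scale: "trig_poly M f \<Longrightarrow> trig_poly M (\<lambda>z. c * f z)"
| cong: "trig_poly M f \<Longrightarrow> (\<And>z. z \<in> circle \<Longrightarrow> f z = g z) \<Longrightarrow> trig_poly M g"

lemma trig_poly_const: "trig_poly M (\<lambda>z. c)"
  using trig_poly.scale[OF trig_poly.monom[of 0 M], of c] by simp

lemma trig_poly_sum: "(\<And>i. i \<in> I \<Longrightarrow> trig_poly M (f i)) \<Longrightarrow> trig_poly M (\<lambda>z. \<Sum>i\<in>I. f i z)"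
  by (induction I rule: infinite_finite_induct) (simp_all add: trig_poly_const trig_poly.add)

lemma circle_nz: "z \<in> circle \<Longrightarrow> z \<noteq> 0"
  by auto

lemma trig_poly_mult:
  assumes "trig_poly M f" "trig_poly N g"
  shows "trig_poly (M + N) (\<lambda>z. f z * g z)"
  using assms(1)
proof induction
  case (monom k)
  show ?case using assms(2)
  proof induction
    case (monom l)
    show ?case
    proof (rule trig_poly.cong)
      show "trig_poly (M + N) (\<lambda>z. z powi (k + l))"
        using monom \<open>\<bar>k\<bar> \<le> int M\<close> by (intro trig_poly.monom) auto
      show "z powi (k + l) = z powi k * z powi l" if "z \<in> circle" for z
        using circle_nz[OF that] by (simp add: power_int_add)
    qed
  next
    case (add f g)
    thus ?case using trig_poly.add by (fastforce simp: algebra_simps)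
  next
    case (scale f c)
    thus ?case using trig_poly.scale[OF scale.IH, of c] by (simp add: mult_ac)
  next
    case (cong f g)
    show ?case by (rule trig_poly.cong[OF cong.IH]) (use cong in simp)
  qed
next
  case (add f g)
  thus ?case using trig_poly.add by (fastforce simp: algebra_simps)
next
  case (scale f c)
  thus ?case using trig_poly.scale[OF scale.IH, of c] by (simp add: mult_ac)
next
  case (cong f g)
  show ?case by (rule trig_poly.cong[OF cong.IH]) (use cong in simp)
qed

lemma continuous_on_powi_circle [continuous_intros]: "continuous_on circle (\<lambda>z. z powi k :: complex)"
  by (intro continuous_intros) auto

lemma trig_poly_continuous: "trig_poly M f \<Longrightarrow> continuous_on circle f"
proof (induction rule: trig_poly.induct)
  case (cong f g)
  thus ?case using continuous_on_cong by metis
qed (auto intro!: continuous_intros)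

lemma cmean_powi_mult_trig_poly:
  assumes "trig_poly M f" "int M < \<bar>e\<bar>"
  shows "cmean (\<lambda>z. z powi e * f z) = 0"
proof -
  have cont: "continuous_on circle (\<lambda>z. z powi e * h z)" if "trig_poly M h" for h
    by (intro continuous_on_mult continuous_on_powi_circle trig_poly_continuous[OF that])
  from assms(1) show ?thesis
  proof induction
    case (monom k)
    have "cmean (\<lambda>z. z powi e * z powi k) = cmean (\<lambda>z. z powi (e + k))"
      by (rule cmean_cong) (use circle_nz in \<open>simp add: power_int_add\<close>)
    thus ?case using monom assms(2) by (auto simp: cmean_power)
  next
    case (add f g)
    from cmean_add[OF cont[OF add.hyps(1)] cont[OF add.hyps(2)]] add.IH show ?case by (simp add: algebra_simps)
  next
    case (scale f c)
    from cmean_mult_left[OF cont[OF scale.hyps], of c] scale.IH show ?case by (simp add: mult_ac)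
  next
    case (cong f g)
    thus ?case by (metis (no_types, lifting) cmean_cong)
  qed
qed

lemma cnj_power_mult_power: "z \<in> circle \<Longrightarrow> cnj (z ^ i) * z ^ j = z powi (int j - int i)"
proof -
  assume z: "z \<in> circle"
  hence "z * cnj z = 1" using complex_norm_square[of z] by simp
  hence "cnj z = inverse z" by (metis inverse_unique)
  thus ?thesis using circle_nz[OF z]
    unfolding complex_cnj_power \<open>cnj z = inverse z\<close>
    by (simp add: power_int_diff power_inverse divide_inverse mult.commute)
qed

lemma trig_poly_cnj_poly_mult_poly:
  assumes "degree p \<le> N" "degree q \<le> N"
  shows "trig_poly N (\<lambda>z. cnj (poly p z) * poly q z)"
proof (rule trig_poly.cong)
  show "trig_poly N (\<lambda>z. \<Sum>i\<le>degree p. \<Sum>j\<le>degree q. (cnj (coeff p i) * coeff q j) * z powi (int j - int i))"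
    using assms by (intro trig_poly_sum trig_poly.scale trig_poly.monom) auto
  show "(\<Sum>i\<le>degree p. \<Sum>j\<le>degree q. (cnj (coeff p i) * coeff q j) * z powi (int j - int i))
    = cnj (poly p z) * poly q z" if "z \<in> circle" for z
    unfolding poly_altdef cnj_sum sum_product
    by (intro sum.cong refl) (simp add: cnj_power_mult_power[OF that, symmetric] mult_ac)
qed

definition trig_mat :: "nat \<Rightarrow> (complex \<Rightarrow> 'm::finite cmat) \<Rightarrow> bool" where
  "trig_mat M G \<longleftrightarrow> (\<forall>i j. trig_poly M (\<lambda>z. G z $ i $ j))"

definition poly_mat :: "nat \<Rightarrow> (complex \<Rightarrow> 'm::finite cmat) \<Rightarrow> bool" where
  "poly_mat N P \<longleftrightarrow> (\<forall>i j. \<exists>p. degree p \<le> N \<and> (\<forall>z. P z $ i $ j = poly p z))"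

lemma trig_mat_const: "trig_mat M (\<lambda>z. A)"
  by (simp add: trig_mat_def trig_poly_const)

lemma trig_mat_continuous: "trig_mat M G \<Longrightarrow> continuous_on circle G"
  unfolding trig_mat_def using trig_poly_continuous by (intro continuous_on_matI) blast

lemma poly_mat_continuous:
  assumes "poly_mat N P" shows "continuous_on S P"
proof (rule continuous_on_matI)
  fix i j
  obtain p where p: "\<And>z. P z $ i $ j = poly p z" using assms unfolding poly_mat_def by blast
  show "continuous_on S (\<lambda>z. P z $ i $ j)" unfolding p by (intro continuous_intros)
qed

lemma poly_mat_const: "poly_mat N (\<lambda>z. A)"
  unfolding poly_mat_def by (intro allI exI[of _ "[:A $ i $ j:]" for i j]) simp

lemma poly_mat_mono: "poly_mat N P \<Longrightarrow> N \<le> N' \<Longrightarrow> poly_mat N' P"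
  unfolding poly_mat_def by (meson order_trans)

lemma poly_mat_scale_poly:
  assumes "poly_mat N P" "degree q \<le> D"
  shows "poly_mat (D + N) (\<lambda>z. cscale (poly q z) (P z))"
  unfolding poly_mat_def
proof (intro allI)
  fix i j
  obtain p where p: "degree p \<le> N" "\<And>z. P z $ i $ j = poly p z"
    using assms(1) unfolding poly_mat_def by blast
  show "\<exists>p. degree p \<le> D + N \<and> (\<forall>z. cscale (poly q z) (P z) $ i $ j = poly p z)"
    using p assms(2) order_trans[OF degree_mult_le[of q p]] by (intro exI[of _ "q * p"]) auto
qed

lemma poly_mat_sum:
  assumes "\<And>t. t \<in> I \<Longrightarrow> poly_mat N (P t)"
  shows "poly_mat N (\<lambda>z. \<Sum>t\<in>I. P t z)"
  unfolding poly_mat_def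
proof (intro allI)
  fix i j
  have "\<forall>t. \<exists>p. t \<in> I \<longrightarrow> degree p \<le> N \<and> (\<forall>z. P t z $ i $ j = poly p z)"
    using assms unfolding poly_mat_def by blast
  then obtain p where "\<And>t. t \<in> I \<Longrightarrow> degree (p t) \<le> N \<and> (\<forall>z. P t z $ i $ j = poly (p t) z)" by metis
  thus "\<exists>p. degree p \<le> N \<and> (\<forall>z. (\<Sum>t\<in>I. P t z) $ i $ j = poly p z)"
    by (intro exI[of _ "\<Sum>t\<in>I. p t"] conjI)
       (cases "finite I", auto simp: poly_sum intro!: degree_sum_le)
qed

lemma poly_mat_cscale: "poly_mat N P \<Longrightarrow> poly_mat N (\<lambda>z. cscale c (P z))"
  using poly_mat_scale_poly[of N P "[:c:]" 0] by simp

lemma poly_mat_shift: "poly_mat N P \<Longrightarrow> poly_mat (k + N) (\<lambda>z. cscale (z ^ k) (P z))"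
  using poly_mat_scale_poly[of N P "monom 1 k" k] by (simp add: degree_monom_le poly_monom)

lemma trig_mat_sandwich_integrand:
  assumes "poly_mat N P" "trig_mat M G" "poly_mat N R"
  shows "trig_mat (M + N) (\<lambda>z. adj (P z) ** G z ** R z)"
  unfolding trig_mat_def
proof (intro allI)
  fix i j
  have "trig_poly (M + N) (\<lambda>z. G z $ l $ k * (cnj (P z $ l $ i) * R z $ k $ j))" for k l
  proof -
    obtain p where p: "degree p \<le> N" "\<And>z. P z $ l $ i = poly p z"
      using assms(1) unfolding poly_mat_def by blast
    obtain q where q: "degree q \<le> N" "\<And>z. R z $ k $ j = poly q z"
      using assms(3) unfolding poly_mat_def by blast
    show ?thesis unfolding p(2) q(2)
      by (intro trig_poly_mult trig_poly_cnj_poly_mult_poly p q) (use assms(2) in \<open>simp add: trig_mat_def\<close>)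
  qed
  hence "trig_poly (M + N) (\<lambda>z. \<Sum>k\<in>UNIV. \<Sum>l\<in>UNIV. G z $ l $ k * (cnj (P z $ l $ i) * R z $ k $ j))"
    by (intro trig_poly_sum)
  thus "trig_poly (M + N) (\<lambda>z. (adj (P z) ** G z ** R z) $ i $ j)"
    by (simp add: mm_nth sum_distrib_right sum_distrib_left mult_ac)
qed

lemma cmean_nth: "continuous_on circle F \<Longrightarrow> cmean F $ i $ j = cmean (\<lambda>z. (F z :: 'm::finite cmat) $ i $ j)"
  by (rule cmean_linear[symmetric, OF bounded_linear_compose[OF bounded_linear_vec_nth bounded_linear_vec_nth]])

text \<open>The key orthogonality. Blocks multiplied by powers of \<open>z\<close> that lie more than \<open>M + N\<close> apart do not
  interact when tested against trigonometric polynomials of degree at most \<open>M\<close>: each cross term is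
  such a polynomial of degree at most \<open>M + N\<close> times a higher power of \<open>z\<close>, so its mean vanishes. Thus a
  sum of maps \<open>f \<mapsto> \<integral> P\<^sub>t\<^sup>* f P\<^sub>t\<close> is again given by a single matrix polynomial.\<close>

lemma sandwich_blocks:
  assumes I: "finite I" and P: "\<And>t. t \<in> I \<Longrightarrow> poly_mat N (P t)" and G: "trig_mat M G"
    and sep: "\<And>s t. s \<in> I \<Longrightarrow> t \<in> I \<Longrightarrow> s \<noteq> t \<Longrightarrow> int (M + N) < \<bar>int (k t) - int (k s)\<bar>"
  shows "sandwich (\<lambda>z. \<Sum>t\<in>I. cscale (z ^ k t) (P t z)) G = (\<Sum>t\<in>I. sandwich (P t) (G :: _ \<Rightarrow> 'm::finite cmat))"
proof -
  let ?F = "\<lambda>s t z. adj (P s z) ** G z ** P t z"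
  let ?H = "\<lambda>s t z. cscale (z powi (int (k t) - int (k s))) (?F s t z)"
  have tm: "trig_mat (M + N) (?F s t)" if "s \<in> I" "t \<in> I" for s t
    using that by (intro trig_mat_sandwich_integrand P G)
  have cont: "continuous_on circle (?H s t)" if "s \<in> I" "t \<in> I" for s t
    by (intro continuous_on_cscale continuous_on_powi_circle trig_mat_continuous[OF tm[OF that]])
  have off: "cmean (?H s t) = (if s = t then sandwich (P s) G else 0)" if st: "s \<in> I" "t \<in> I" for s t
  proof (cases "s = t")
    case False
    have "cmean (?H s t) $ i $ j = 0" for i j
      unfolding cmean_nth[OF cont[OF st]] cscale_nth
      using tm[OF st] sep[OF st False] by (intro cmean_powi_mult_trig_poly) (auto simp: trig_mat_def)
    thus ?thesis using False by (simp add: mat_eq_iff)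
  qed (simp add: sandwich_def)
  have "sandwich (\<lambda>z. \<Sum>t\<in>I. cscale (z ^ k t) (P t z)) G = cmean (\<lambda>z. \<Sum>t\<in>I. \<Sum>s\<in>I. ?H s t z)"
    unfolding sandwich_def
    by (rule cmean_cong)
       (simp add: adj_sum sum_mm_left sum_mm_right adj_cscale cscale_mm_left cscale_mm_right cscale_sum cscale_cscale
          cnj_power_mult_power[symmetric] mult.commute)
  also have "\<dots> = (\<Sum>t\<in>I. \<Sum>s\<in>I. cmean (?H s t))"
    by (subst cmean_sum, rule I, (intro continuous_intros cont; assumption), intro sum.cong refl, subst cmean_sum)
       (auto intro!: cont I)
  also have "\<dots> = (\<Sum>t\<in>I. \<Sum>s\<in>I. (if s = t then sandwich (P s) G else 0))"
    by (intro sum.cong refl off)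
  also have "\<dots> = (\<Sum>t\<in>I. sandwich (P t) G)" using I by simp
  finally show ?thesis .
qed

section \<open>Kraus decomposition\<close>

text \<open>One step of Gaussian elimination: \<open>w\<close> is the row of the pivot \<open>a\<close> divided by the square root of the
  pivot, and the Schur complement \<open>B\<close> is again positive because any vector on \<open>I\<close> can be extended to
  \<open>a\<close> by the value \<open>t\<close> that minimises the form. A vanishing pivot has a vanishing row.\<close>

lemma psd_gram:
  fixes A :: "'a \<Rightarrow> 'a \<Rightarrow> complex"
  assumes "finite I"
    and "\<And>x. (\<Sum>i\<in>I. \<Sum>j\<in>I. cnj (x i) * A i j * x j) \<in> \<real>\<^sub>\<ge>\<^sub>0"
  shows "\<exists>v. \<forall>i\<in>I. \<forall>j\<in>I. A i j = (\<Sum>s\<in>I. cnj (v s i) * v s j)"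
  using assms
proof (induction I arbitrary: A rule: finite_induct)
  case empty
  thus ?case by simp
next
  case (insert a I)
  have psd: "cnj t * A a a * t + cnj t * (\<Sum>j\<in>I. A a j * x j) + (\<Sum>i\<in>I. cnj (x i) * A i a) * t
      + (\<Sum>i\<in>I. \<Sum>j\<in>I. cnj (x i) * A i j * x j) \<in> \<real>\<^sub>\<ge>\<^sub>0" for t x
  proof -
    let ?y = "x(a := t)"
    have eq: "(\<Sum>j\<in>I. c * A i j * ?y j) = (\<Sum>j\<in>I. c * A i j * x j)" for c i
      using insert.hyps by (intro sum.cong) auto
    have "(\<Sum>i\<in>insert a I. \<Sum>j\<in>insert a I. cnj (?y i) * A i j * ?y j)
      = cnj t * A a a * t + (\<Sum>j\<in>I. cnj t * A a j * x j) +
        (\<Sum>i\<in>I. cnj (?y i) * A i a * t + (\<Sum>j\<in>I. cnj (?y i) * A i j * x j))"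
      unfolding sum.insert[OF insert.hyps] eq by simp
    also have "(\<Sum>i\<in>I. cnj (?y i) * A i a * t + (\<Sum>j\<in>I. cnj (?y i) * A i j * x j))
      = (\<Sum>i\<in>I. cnj (x i) * A i a * t + (\<Sum>j\<in>I. cnj (x i) * A i j * x j))"
      using insert.hyps by (intro sum.cong) auto
    finally show ?thesis using insert.prems[of ?y]
      by (simp add: sum.distrib sum_distrib_left sum_distrib_right mult.assoc add.assoc)
  qed
  define d where "d = Re (A a a)"
  have Aaa: "A a a = of_real d" "d \<ge> 0"
    using psd[of 1 "\<lambda>_. 0"] by (auto simp: d_def complex_nonneg_Reals_iff complex_eq_iff)
  have two: "cnj t * A a a * t + cnj t * A a j * s + cnj s * A j a * t + cnj s * A j j * s \<in> \<real>\<^sub>\<ge>\<^sub>0"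
    if j: "j \<in> I" for j s t
  proof -
    have 1: "(\<Sum>i\<in>I. f i * (if i = j then s else 0)) = f j * s" for f
      using j insert.hyps by (simp add: if_distrib cong: if_cong)
    have 2: "(\<Sum>i\<in>I. cnj (if i = j then s else 0) * f i) = cnj s * f j" for f
      using j insert.hyps by (simp add: if_distribR if_distrib[of cnj] if_distrib[of "\<lambda>x. x * _"] cong: if_cong)
    show ?thesis using psd[of t "\<lambda>i. if i = j then s else 0"]
      by (simp only: 1 2 mult.assoc flip: sum_distrib_left)
  qed
  have herm: "A j a = cnj (A a j)" if j: "j \<in> I" for j
  proof -
    have "Im (A j j) = 0" using two[OF j, of 0 1] by (simp add: complex_nonneg_Reals_iff)
    hence "Im (A a j) + Im (A j a) = 0"
      using two[OF j, of 1 1] Aaa by (simp add: complex_nonneg_Reals_iff)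
    moreover have "Re (A a j) - Re (A j a) = 0"
      using two[OF j, of \<i> 1] Aaa \<open>Im (A j j) = 0\<close> by (simp add: complex_nonneg_Reals_iff)
    ultimately show ?thesis by (simp add: complex_eq_iff)
  qed
  define w where "w j = (if d = 0 then 0 else A a j / of_real (sqrt d))" for j
  have wa: "w a = of_real (sqrt d)" using Aaa
    by (simp add: w_def field_simps flip: of_real_mult)
  have Aaj: "A a j = of_real (sqrt d) * w j" if j: "j \<in> I" for j
  proof (cases "d = 0")
    case True
    have "A a j = 0"
    proof (rule ccontr)
      assume nz: "A a j \<noteq> 0"
      define e where "e = (cmod (A a j))\<^sup>2"
      have e: "e > 0" "A a j * cnj (A a j) = of_real e" using nz complex_norm_square[of "A a j"] by (simp_all add: e_def)
      have "Re (A j j) - 2 * r * e \<ge> 0" for r :: real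
      proof -
        let ?t = "- of_real r * A a j"
        have t: "cnj ?t * A a j = of_real (- r * e)" "A j a * ?t = of_real (- r * e)" "A a a = 0"
          using e(2) herm[OF j] True Aaa by (simp_all add: mult_ac)
        have "of_real (- r * e) + of_real (- r * e) + A j j \<in> \<real>\<^sub>\<ge>\<^sub>0"
          using two[OF j, of ?t 1]
          by (simp only: complex_cnj_one mult_1_left mult_1_right t mult_zero_left mult_zero_right add_0)
        thus ?thesis by (simp add: complex_nonneg_Reals_iff mult_ac)
      qed
      \<comment> \<open>The form restricted to \<open>{a, j}\<close> would be affine and unbounded below in \<open>r\<close>.\<close>
      from this[of "(Re (A j j) + 1) / (2 * e)"] e(1) show False by (simp add: field_simps)
    qed
    thus ?thesis using True by (simp add: w_def)
  qed (use Aaa in \<open>simp add: w_def\<close>)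
  define B where "B i j = A i j - cnj (w i) * w j" for i j
  have "(\<Sum>i\<in>I. \<Sum>j\<in>I. cnj (x i) * B i j * x j) \<in> \<real>\<^sub>\<ge>\<^sub>0" for x
  proof -
    define W where "W = (\<Sum>j\<in>I. w j * x j)"
    define t where "t = (if d = 0 then 0 else - W / of_real (sqrt d))"
    have t: "of_real (sqrt d) * t = (if d = 0 then 0 else - W)" using Aaa by (simp add: t_def)
    have W0: "W = 0" if "d = 0" using that by (simp add: W_def w_def)
    have s1: "(\<Sum>j\<in>I. A a j * x j) = of_real (sqrt d) * W"
      by (simp add: W_def sum_distrib_left Aaj mult.assoc)
    have s2: "(\<Sum>i\<in>I. cnj (x i) * A i a) = of_real (sqrt d) * cnj W"
      by (simp add: W_def sum_distrib_left Aaj herm mult_ac)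
    have dd: "complex_of_real d = of_real (sqrt d) * of_real (sqrt d)"
      using Aaa by (simp flip: of_real_mult)
    have "cnj t * A a a * t + cnj t * (\<Sum>j\<in>I. A a j * x j) + (\<Sum>i\<in>I. cnj (x i) * A i a) * t
      = cnj (of_real (sqrt d) * t) * (of_real (sqrt d) * t) + cnj (of_real (sqrt d) * t) * W + cnj W * (of_real (sqrt d) * t)"
      unfolding s1 s2 Aaa(1) dd by (simp add: mult_ac)
    also have "\<dots> = - (cnj W * W)"
      unfolding t using W0 by (auto simp: mult_ac)
    also have "cnj W * W = (\<Sum>i\<in>I. \<Sum>j\<in>I. cnj (x i) * (cnj (w i) * w j) * x j)"
      unfolding W_def cnj_sum sum_product by (intro sum.cong refl) (simp add: mult_ac)
    finally have "(\<Sum>i\<in>I. \<Sum>j\<in>I. cnj (x i) * B i j * x j) =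
       cnj t * A a a * t + cnj t * (\<Sum>j\<in>I. A a j * x j) + (\<Sum>i\<in>I. cnj (x i) * A i a) * t
      + (\<Sum>i\<in>I. \<Sum>j\<in>I. cnj (x i) * A i j * x j)"
      by (simp add: B_def algebra_simps sum_subtractf)
    thus ?thesis using psd[of t x] by simp
  qed
  from insert.IH[OF this] obtain v where v: "\<And>i j. i \<in> I \<Longrightarrow> j \<in> I \<Longrightarrow> B i j = (\<Sum>s\<in>I. cnj (v s i) * v s j)"
    by blast
  define u where "u s i = (if s = a then w i else if i = a then 0 else v s i)" for s i
  have "A i j = (\<Sum>s\<in>insert a I. cnj (u s i) * u s j)" if "i \<in> insert a I" "j \<in> insert a I" for i j
  proof -
    have "(\<Sum>s\<in>insert a I. cnj (u s i) * u s j) = cnj (w i) * w j + (\<Sum>s\<in>I. cnj (u s i) * u s j)"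
      using insert.hyps by (simp add: u_def)
    also have "(\<Sum>s\<in>I. cnj (u s i) * u s j) = (if i = a \<or> j = a then 0 else B i j)"
    proof (cases "i = a \<or> j = a")
      case False
      have "(\<Sum>s\<in>I. cnj (u s i) * u s j) = (\<Sum>s\<in>I. cnj (v s i) * v s j)"
        using False insert.hyps by (intro sum.cong) (auto simp: u_def)
      thus ?thesis using False v that by auto
    next
      case True
      thus ?thesis using insert.hyps by (auto simp: u_def intro!: sum.neutral)
    qed
    finally show ?thesis
      using that insert.hyps Aaa Aaj herm wa by (auto simp: B_def mult.commute simp flip: of_real_mult)
  qed
  thus ?case by blast
qed

definition matrix_unit :: "'m \<Rightarrow> 'm \<Rightarrow> 'm::finite cmat" where
  "matrix_unit k l = (\<chi> i j. if i = k \<and> j = l then 1 else 0)"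

lemma matrix_unit_mv: "matrix_unit k l *v x = axis k (x $ l)"
  by (auto simp: vec_eq_iff mv_nth matrix_unit_def axis_def if_distrib if_distribR cong: if_cong)

lemma cinner_axis_right: "cinner x (axis k c) = cnj (x $ k) * c"
  by (simp add: cinner_def axis_def if_distrib cong: if_cong)

lemma matrix_unit_expansion: "(A::'m::finite cmat) = (\<Sum>k\<in>UNIV. \<Sum>l\<in>UNIV. cscale (A $ k $ l) (matrix_unit k l))"
proof -
  have "(\<Sum>k\<in>UNIV. \<Sum>l\<in>UNIV. A $ k $ l * matrix_unit k l $ i $ j) = A $ i $ j" for i j
  proof -
    have "(\<Sum>k\<in>UNIV. \<Sum>l\<in>UNIV. A $ k $ l * matrix_unit k l $ i $ j) =
        (\<Sum>k\<in>UNIV. if k = i then (\<Sum>l\<in>UNIV. if l = j then A $ k $ l else 0) else 0)"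
      by (intro sum.cong refl) (auto simp: matrix_unit_def if_distrib cong: if_cong)
    thus ?thesis by simp
  qed
  thus ?thesis by (simp add: mat_eq_iff)
qed

text \<open>Choi's argument for the completely positive map \<open>A \<mapsto> \<phi> (h A)\<close> on matrices: the block matrix of its values
  on the matrix units is positive, and a Gram factorisation of it consists of the entries of the Kraus
  operators. Their number does not depend on \<open>\<phi>\<close>, which is what makes the degree bound in
  \<open>ucp_approx\<close> uniform.\<close>

lemma ucp_kraus:
  fixes \<phi> :: "(complex \<Rightarrow> 'm::finite cmat) \<Rightarrow> 'm cmat" and h :: "complex \<Rightarrow> real"
  assumes \<phi>: "\<phi> \<in> ucp" and h: "continuous_on circle h" "\<And>z. z \<in> circle \<Longrightarrow> 0 \<le> h z"
  shows "\<exists>K :: 'm \<times> 'm \<Rightarrow> 'm cmat. \<forall>A. \<phi> (\<lambda>z. cscale (of_real (h z)) A) = (\<Sum>s\<in>UNIV. adj (K s) ** A ** K s)"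
proof -
  let ?n = "CARD('m)"
  obtain b :: "nat \<Rightarrow> 'm" where b: "bij_betw b {..<?n} UNIV"
    using ex_bij_betw_nat_finite[of "UNIV :: 'm set"] by (auto simp: atLeast0LessThan)
  define C :: "'m \<Rightarrow> 'm \<Rightarrow> 'm cmat" where "C k l = \<phi> (\<lambda>z. cscale (of_real (h z)) (matrix_unit k l))" for k l
  have cont: "continuous_on circle (\<lambda>z. cscale (of_real (h z)) A)" for A :: "'m cmat"
    by (intro continuous_intros h)
  have pt: "block_psd ?n (\<lambda>i j. cscale (of_real (h z)) (matrix_unit (b i) (b j)))" if z: "z \<in> circle" for z
    unfolding block_psd_def
  proof
    fix x :: "nat \<Rightarrow> complex ^ 'm"
    let ?S = "\<Sum>i<?n. x i $ b i"
    have "(\<Sum>i<?n. \<Sum>j<?n. cinner (x i) (cscale (of_real (h z)) (matrix_unit (b i) (b j)) *v x j))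
       = of_real (h z) * (cnj ?S * ?S)"
      unfolding cnj_sum sum_product unfolding sum_distrib_left
      by (simp add: cscale_mv cinner_scale_right matrix_unit_mv cinner_axis_right)
    also have "\<dots> = of_real (h z * (cmod ?S)\<^sup>2)"
      using complex_norm_square[of ?S] by (simp add: mult.commute)
    also have "\<dots> \<in> \<real>\<^sub>\<ge>\<^sub>0" using h(2)[OF z] by (simp only: nonneg_Reals_of_real_iff) simp
    finally show "(\<Sum>i<?n. \<Sum>j<?n. cinner (x i) (cscale (of_real (h z)) (matrix_unit (b i) (b j)) *v x j)) \<in> \<real>\<^sub>\<ge>\<^sub>0" .
  qed
  have psd: "block_psd ?n (\<lambda>i j. C (b i) (b j))"
    unfolding C_def by (rule ucp_block_psd[OF \<phi> cont pt])
  have "(\<Sum>i\<in>UNIV. \<Sum>j\<in>UNIV. cnj (x i) * C (fst i) (fst j) $ snd i $ snd j * x j) \<in> \<real>\<^sub>\<ge>\<^sub>0" for x :: "'m \<times> 'm \<Rightarrow> complex"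
  proof -
    have "(\<Sum>i\<in>UNIV. \<Sum>j\<in>UNIV. cnj (x i) * C (fst i) (fst j) $ snd i $ snd j * x j) =
      (\<Sum>k\<in>UNIV. \<Sum>p\<in>UNIV. \<Sum>l\<in>UNIV. \<Sum>q\<in>UNIV. cnj (x (k, p)) * C k l $ p $ q * x (l, q))"
      unfolding UNIV_Times_UNIV[symmetric] sum.cartesian_product' by simp
    also have "\<dots> = (\<Sum>k\<in>UNIV. \<Sum>l\<in>UNIV. \<Sum>p\<in>UNIV. \<Sum>q\<in>UNIV. cnj (x (k, p)) * C k l $ p $ q * x (l, q))"
      by (rule sum.cong[OF refl sum.swap])
    also have "\<dots> = (\<Sum>k\<in>UNIV. \<Sum>l\<in>UNIV. cinner (\<chi> p. x (k, p)) (C k l *v (\<chi> q. x (l, q))))"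
      by (simp add: cinner_def mv_nth sum_distrib_left mult.assoc)
    also have "\<dots> = (\<Sum>i<?n. \<Sum>j<?n. cinner (\<chi> p. x (b i, p)) (C (b i) (b j) *v (\<chi> q. x (b j, q))))"
      by (simp add: sum.reindex_bij_betw[OF b, symmetric])
    also have "\<dots> \<in> \<real>\<^sub>\<ge>\<^sub>0"
      using psd[unfolded block_psd_def, rule_format, of "\<lambda>i. \<chi> p. x (b i, p)"] .
    finally show ?thesis .
  qed
  from psd_gram[OF finite this] obtain v :: "'m \<times> 'm \<Rightarrow> 'm \<times> 'm \<Rightarrow> complex" where
    v: "\<forall>i\<in>UNIV. \<forall>j\<in>UNIV. C (fst i) (fst j) $ snd i $ snd j = (\<Sum>s\<in>UNIV. cnj (v s i) * v s j)"
    by blast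
  define K where "K s = (\<chi> k p. v s (k, p))" for s
  have CK: "C k l = (\<Sum>s\<in>UNIV. adj (K s) ** matrix_unit k l ** K s)" for k l
  proof -
    have "(adj (K s) ** matrix_unit k l ** K s) $ p $ q = cnj (v s (k, p)) * v s (l, q)" for s p q
    proof -
      have "(adj (K s) ** matrix_unit k l ** K s) $ p $ q =
         (\<Sum>j\<in>UNIV. \<Sum>i\<in>UNIV. cnj (v s (i, p)) * (matrix_unit k l $ i $ j * v s (j, q)))"
        by (simp add: mm_nth K_def sum_distrib_right sum_distrib_left mult_ac)
      also have "\<dots> = (\<Sum>j\<in>UNIV. if j = l then (\<Sum>i\<in>UNIV. if i = k then cnj (v s (i, p)) * v s (j, q) else 0) else 0)"
        by (intro sum.cong refl) (auto simp: matrix_unit_def if_distrib[of "\<lambda>x. x * _"] if_distrib[of "\<lambda>x. _ * x"] cong: if_cong)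
      finally show ?thesis by (simp add: if_distrib cong: if_cong)
    qed
    thus ?thesis using v by (simp add: mat_eq_iff)
  qed
  have "\<phi> (\<lambda>z. cscale (of_real (h z)) A) = (\<Sum>s\<in>UNIV. adj (K s) ** A ** K s)" for A
  proof -
    have "(\<lambda>z. cscale (of_real (h z)) A) =
       (\<lambda>z. \<Sum>k\<in>UNIV. \<Sum>l\<in>UNIV. cscale (A $ k $ l) (cscale (of_real (h z)) (matrix_unit k l)))"
      by (subst matrix_unit_expansion[of A]) (simp add: cscale_sum cscale_cscale mult.commute)
    hence "\<phi> (\<lambda>z. cscale (of_real (h z)) A) = (\<Sum>k\<in>UNIV. \<Sum>l\<in>UNIV. cscale (A $ k $ l) (C k l))"
      by (simp add: ucp_sum[OF \<phi>] continuous_on_sum continuous_on_cscale cont ucp_cscale[OF \<phi> cont] C_def)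
    also have "\<dots> = (\<Sum>k\<in>UNIV. \<Sum>l\<in>UNIV. \<Sum>s\<in>UNIV. adj (K s) ** cscale (A $ k $ l) (matrix_unit k l) ** K s)"
      by (simp add: CK cscale_sum cscale_mm_left cscale_mm_right)
    also have "\<dots> = (\<Sum>s\<in>UNIV. \<Sum>k\<in>UNIV. \<Sum>l\<in>UNIV. adj (K s) ** cscale (A $ k $ l) (matrix_unit k l) ** K s)"
      by (subst sum.swap[of _ UNIV "UNIV :: ('m \<times> 'm) set"], subst sum.swap[of _ UNIV "UNIV :: ('m \<times> 'm) set"]) (rule refl)
    also have "\<dots> = (\<Sum>s\<in>UNIV. adj (K s) ** A ** K s)"
      by (subst (2) matrix_unit_expansion[of A]) (simp add: sum_mm_left sum_mm_right)
    finally show ?thesis .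
  qed
  thus ?thesis by blast
qed

section \<open>A positive kernel and its peak polynomials\<close>

text \<open>A power of \<open>(1 + Re w) / 2\<close>, normalised to have mean one; it peaks at \<open>w = 1\<close>.\<close>

definition kern :: "nat \<Rightarrow> complex \<Rightarrow> real" where
  "kern M w = 4 ^ M / (2 * M choose M) * ((1 + Re w) / 2) ^ M"

lemma kern_nonneg: "w \<in> circle \<Longrightarrow> 0 \<le> kern M w"
  using abs_Re_le_cmod[of w] by (auto simp: kern_def)

lemma circle_cnj: "w \<in> circle \<Longrightarrow> cnj w = inverse w"
  using complex_norm_square[of w] by (simp add: inverse_unique)

lemma circle_mult_cnj: "z \<in> circle \<Longrightarrow> y \<in> circle \<Longrightarrow> z * cnj y \<in> circle"
  by (simp add: norm_mult)

text \<open>On the circle \<open>(1 + Re w) / 2 = (w + 1)\<^sup>2 / (4 w)\<close>, so the binomial theorem gives all Fourier coefficients.\<close>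

lemma kern_expansion:
  assumes w: "w \<in> circle"
  shows "complex_of_real (kern M w) =
     (\<Sum>k\<le>2*M. of_real (real (2*M choose k) / real (2*M choose M)) * w powi (int k - int M))"
proof -
  have nz: "w \<noteq> 0" using w by auto
  have "of_real (Re w) = (w + cnj w) / 2" by (simp add: complex_add_cnj)
  hence e: "w * (2 * of_real (Re w)) = 1 + w * w"
    using nz unfolding circle_cnj[OF w] by (simp add: field_simps)
  have "4 * w * complex_of_real (Re w) = 2 * (w * (2 * of_real (Re w)))" by simp
  also have "\<dots> = 2 * (w * w) + 2" unfolding e by simp
  finally have "4 * w * complex_of_real (Re w) = 2 * (w * w) + 2" .
  hence "complex_of_real ((1 + Re w) / 2) * (4 * w) = (w + 1) ^ 2"
    by (simp add: algebra_simps power2_eq_square)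
  hence *: "complex_of_real ((1 + Re w) / 2) = (w + 1) ^ 2 / (4 * w)"
    using nz by (simp add: nonzero_eq_divide_eq del: of_real_divide of_real_add)
  have "complex_of_real (kern M w) = of_real (4 ^ M / real (2*M choose M)) * ((w + 1) ^ 2 / (4 * w)) ^ M"
    unfolding kern_def of_real_mult of_real_power * ..
  also have "\<dots> = (w + 1) ^ (2*M) / (of_real (real (2*M choose M)) * w ^ M)"
    by (simp add: power_divide power_mult_distrib power_mult)
  also have "\<dots> = (\<Sum>k\<le>2*M. of_nat (2*M choose k) * w ^ k) / (of_real (real (2*M choose M)) * w ^ M)"
    by (subst binomial_ring) simp
  also have "\<dots> = (\<Sum>k\<le>2*M. of_real (real (2*M choose k) / real (2*M choose M)) * w powi (int k - int M))"
    using nz by (simp add: sum_divide_distrib power_int_diff)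
  finally show ?thesis .
qed

text \<open>Both the mean over the circle and the mean over sufficiently many roots of unity annihilate the
  nonzero powers occurring in the kernel; \<open>A k\<close> stands for the average of the \<open>k\<close>-th power.\<close>

lemma kern_average_aux:
  assumes A: "\<And>k. \<bar>k\<bar> \<le> int M \<Longrightarrow> A k = (if k = 0 then 1 else 0)"
  shows "(\<Sum>k\<le>2*M. complex_of_real (real (2*M choose k) / real (2*M choose M)) * A (int k - int M)) = 1"
proof -
  have "(\<Sum>k\<le>2*M. complex_of_real (real (2*M choose k) / real (2*M choose M)) * A (int k - int M)) =
     (\<Sum>k\<le>2*M. if k = M then complex_of_real (real (2*M choose k) / real (2*M choose M)) else 0)"
    by (intro sum.cong refl) (auto simp: A)
  thus ?thesis by simp
qed

lemma trig_poly_kern: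
  assumes y: "y \<in> circle"
  shows "trig_poly M (\<lambda>z. of_real (kern M (z * cnj y)))"
proof (rule trig_poly.cong)
  show "trig_poly M (\<lambda>z. \<Sum>k\<le>2*M. of_real (real (2*M choose k) / real (2*M choose M)) * (cnj y powi (int k - int M) * z powi (int k - int M)))"
    by (intro trig_poly_sum trig_poly.scale trig_poly.monom) auto
  show "(\<Sum>k\<le>2*M. of_real (real (2*M choose k) / real (2*M choose M)) * (cnj y powi (int k - int M) * z powi (int k - int M)))
     = complex_of_real (kern M (z * cnj y))" if "z \<in> circle" for z
    unfolding kern_expansion[OF circle_mult_cnj[OF that y]]
    by (simp add: power_int_mult_distrib mult_ac)
qed

lemma kern_continuous [continuous_intros]: "continuous_on S (\<lambda>z. kern M (z * cnj y))"
  unfolding kern_def by (intro continuous_intros) auto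

lemma cmean_of_real: "continuous_on circle g \<Longrightarrow> cmean (\<lambda>z. complex_of_real (g z)) = of_real (cmean g)"
  by (rule cmean_linear[OF bounded_linear_of_real])

lemma cmean_kern:
  assumes y: "y \<in> circle"
  shows "cmean (\<lambda>z. kern M (z * cnj y)) = 1"
proof -
  let ?c = "\<lambda>k. complex_of_real (real (2*M choose k) / real (2*M choose M))"
  have "complex_of_real (cmean (\<lambda>z. kern M (z * cnj y))) = cmean (\<lambda>z. of_real (kern M (z * cnj y)))"
    by (intro cmean_of_real[symmetric] continuous_intros)
  also have "\<dots> = cmean (\<lambda>z. \<Sum>k\<le>2*M. ?c k * cnj y powi (int k - int M) * z powi (int k - int M))"
    by (rule cmean_cong) (simp only: kern_expansion circle_mult_cnj[OF _ y] power_int_mult_distrib mult_ac)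
  also have "\<dots> = (\<Sum>k\<le>2*M. cmean (\<lambda>z. ?c k * cnj y powi (int k - int M) * z powi (int k - int M)))"
    by (rule cmean_sum) (intro finite_atMost continuous_on_mult continuous_on_const continuous_on_powi_circle)+
  also have "\<dots> = (\<Sum>k\<le>2*M. ?c k * (cnj y powi (int k - int M) * cmean (\<lambda>z. z powi (int k - int M))))"
    by (simp only: cmean_mult_left[OF continuous_on_powi_circle]) (simp only: mult.assoc)
  also have "\<dots> = 1"
    by (rule kern_average_aux) (auto simp: cmean_power)
  finally show ?thesis by (simp only: of_real_eq_1_iff)
qed

definition rootpt :: "nat \<Rightarrow> nat \<Rightarrow> complex" where
  "rootpt J j = cis (2 * pi * real j / real J)"

lemma rootpt_circle [simp]: "rootpt J j \<in> circle"
  by (simp add: rootpt_def)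

lemma sum_rootpt_powi:
  assumes "J > 0" "\<bar>e\<bar> < int J"
  shows "(\<Sum>j<J. cnj (rootpt J j) powi e) = (if e = 0 then of_nat J else 0)"
proof (cases "e = 0")
  case False
  define w where "w = cis (- 2 * pi * e / J)"
  have eq: "cnj (rootpt J j) powi e = w ^ j" for j
  proof -
    have "cnj (rootpt J j) powi e = cis (e * (- (2 * pi * real j / real J)))"
      unfolding rootpt_def cis_cnj cis_power_int ..
    moreover have "w ^ j = cis (real j * (- 2 * pi * e / J))"
      unfolding w_def by (rule Complex.DeMoivre)
    ultimately show ?thesis by (simp add: mult_ac)
  qed
  have "w \<noteq> 1"
  proof
    assume "w = 1"
    hence "cos (2 * pi * e / J) = 1" by (simp add: w_def complex_eq_iff)
    then obtain n :: int where "2 * pi * e / J = of_int n * 2 * pi"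
      using cos_one_2pi_int by auto
    hence "real_of_int e = n * real J" using assms(1) by (simp add: field_simps)
    hence "e = n * int J" by (metis of_int_eq_iff of_int_mult of_int_of_nat_eq)
    thus False using False assms(2)
      by (metis abs_mult abs_of_nat dvd_imp_le_int dvd_triv_right leD)
  qed
  moreover have "w ^ J = 1"
  proof -
    have "w ^ J = cis (2 * pi * of_int (- e))" using assms(1) by (simp add: w_def Complex.DeMoivre)
    thus ?thesis by (metis cis_multiple_2pi Ints_of_int)
  qed
  ultimately show ?thesis using False by (simp add: eq geometric_sum)
qed simp

lemma sum_kern_rootpt:
  assumes z: "z \<in> circle" and J: "M < J"
  shows "(\<Sum>j<J. kern M (z * cnj (rootpt J j)) / J) = 1"
proof -
  let ?c = "\<lambda>k. complex_of_real (real (2*M choose k) / real (2*M choose M))"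
  let ?A = "\<lambda>e. z powi e * ((\<Sum>j<J. cnj (rootpt J j) powi e) / of_nat J)"
  have "complex_of_real (\<Sum>j<J. kern M (z * cnj (rootpt J j)) / J) =
     (\<Sum>j<J. \<Sum>k\<le>2*M. ?c k * (z * cnj (rootpt J j)) powi (int k - int M) / of_nat J)"
    by (simp only: of_real_sum of_real_divide kern_expansion[OF circle_mult_cnj[OF z rootpt_circle]] sum_divide_distrib of_real_of_nat_eq)
  also have "\<dots> = (\<Sum>k\<le>2*M. \<Sum>j<J. ?c k * (z * cnj (rootpt J j)) powi (int k - int M) / of_nat J)"
    by (rule sum.swap)
  also have "\<dots> = (\<Sum>k\<le>2*M. ?c k * ?A (int k - int M))"
    by (simp add: power_int_mult_distrib sum_distrib_left sum_divide_distrib mult.assoc times_divide_eq_right del: of_real_divide)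
  also have "\<dots> = 1"
    by (rule kern_average_aux) (use J in \<open>auto simp: sum_rootpt_powi\<close>)
  finally show ?thesis by (simp only: of_real_eq_1_iff)
qed

lemma kern_ratio: "(real (M + 1) * kern M w) * ((1 + Re w) / 2) = (real M + 1 / 2) * kern (Suc M) w"
proof -
  have *: "real (2 * Suc M choose Suc M) * real (M + 1) = 2 * (2 * M + 1) * real (2 * M choose M)"
  proof -
    define f where "f = (fact M :: real)"
    define F where "F = (fact (2 * M) :: real)"
    have 1: "real (2 * Suc M choose Suc M) = fact (2 * Suc M) / (fact (Suc M) * fact (Suc M))"
      by (subst binomial_fact) auto
    have 2: "fact (2 * Suc M) = (2 * real M + 2) * (2 * real M + 1) * F" "fact (Suc M) = (real M + 1) * f"
      by (simp_all add: algebra_simps F_def f_def)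
    have 3: "real (2 * M choose M) = F / (f * f)"
      unfolding F_def f_def by (subst binomial_fact) auto
    have "f \<noteq> 0" "real M + 1 \<noteq> 0" by (simp_all add: f_def)
    thus ?thesis unfolding 1 2 3 by (simp add: divide_simps) (simp add: algebra_simps)
  qed
  define C D X where "C = real (2 * M choose M)" and "D = real (2 * Suc M choose Suc M)" and "X = (1 + Re w) / 2"
  have "C > 0" "D > 0" by (simp_all add: C_def D_def del: mult_Suc_right)
  moreover have "D * (real M + 1) = (4 * real M + 2) * C" using * by (simp add: C_def D_def algebra_simps)
  ultimately have "(real M + 1) / C = (4 * real M + 2) / D" by (simp add: frac_eq_eq mult.commute)
  hence "(real M + 1) / C * (4 ^ M * X ^ Suc M) = (4 * real M + 2) / D * (4 ^ M * X ^ Suc M)" by simp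
  hence "real (M + 1) * (4 ^ M / C * X ^ M) * X = (real M + 1 / 2) * (4 ^ Suc M / D * X ^ Suc M)"
    by (simp add: algebra_simps)
  thus ?thesis unfolding kern_def C_def D_def X_def .
qed

text \<open>Since \<open>\<bar>z - y\<bar>\<^sup>2 = 4 - 4 (1 + Re (z cnj y)) / 2\<close>, multiplying the kernel by the squared distance yields a
  combination of two consecutive kernels. Hence the variance of the kernel under either average is
  \<open>2 / (M + 1)\<close>.\<close>

lemma kern_dist:
  assumes "z \<in> circle" "y \<in> circle"
  shows "kern M (z * cnj y) * (cmod (z - y))\<^sup>2 = 4 * kern M (z * cnj y) - (4 * real M + 2) / (real M + 1) * kern (Suc M) (z * cnj y)"
proof -
  have aux: "2 - 2 * t = 4 - 4 * ((1 + t) / 2)" for t :: real by (simp add: field_simps)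
  have "complex_of_real ((cmod (z - y))\<^sup>2) = z * cnj z + y * cnj y - (z * cnj y + cnj (z * cnj y))"
    unfolding complex_norm_square by (simp add: algebra_simps)
  also have "\<dots> = of_real (2 - 2 * Re (z * cnj y))"
    using assms unfolding complex_add_cnj complex_norm_square[symmetric] by simp
  finally have "(cmod (z - y))\<^sup>2 = 2 - 2 * Re (z * cnj y)"
    by (simp only: of_real_eq_iff)
  hence "(cmod (z - y))\<^sup>2 = 4 - 4 * ((1 + Re (z * cnj y)) / 2)"
    unfolding aux .
  hence "kern M (z * cnj y) * (cmod (z - y))\<^sup>2 = 4 * kern M (z * cnj y) - 4 * (kern M (z * cnj y) * ((1 + Re (z * cnj y)) / 2))"
    by (simp only: right_diff_distrib mult_ac)
  also have "kern M (z * cnj y) * ((1 + Re (z * cnj y)) / 2) = (real M + 1 / 2) / (real M + 1) * kern (Suc M) (z * cnj y)"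
    using kern_ratio[of M "z * cnj y"] by (simp add: field_simps)
  finally show ?thesis by (simp add: field_simps)
qed

lemma kern_variance_eq: "4 - (4 * real M + 2) / (real M + 1) = 2 / (real M + 1)"
  by (simp add: field_simps)

lemma sum_kern_dist:
  assumes z: "z \<in> circle" and J: "Suc M < J"
  shows "(\<Sum>j<J. kern M (z * cnj (rootpt J j)) / J * (cmod (z - rootpt J j))\<^sup>2) = 2 / (real M + 1)"
proof -
  let ?r = "(4 * real M + 2) / (real M + 1)"
  have "(\<Sum>j<J. kern M (z * cnj (rootpt J j)) / J * (cmod (z - rootpt J j))\<^sup>2) =
     (\<Sum>j<J. 4 * (kern M (z * cnj (rootpt J j)) / J) - ?r * (kern (Suc M) (z * cnj (rootpt J j)) / J))"
    by (intro sum.cong refl) (simp only: times_divide_eq_left kern_dist[OF z rootpt_circle] times_divide_eq_right diff_divide_distrib)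
  also have "\<dots> = 4 - ?r"
    using J sum_kern_rootpt[OF z, of M J] sum_kern_rootpt[OF z, of "Suc M" J]
    by (simp only: sum_subtractf sum_distrib_left[symmetric])
  finally show ?thesis by (simp only: kern_variance_eq)
qed

lemma cmean_kern_dist:
  assumes y: "y \<in> circle"
  shows "cmean (\<lambda>z. kern M (z * cnj y) * (cmod (z - y))\<^sup>2) = 2 / (real M + 1)"
proof -
  let ?r = "(4 * real M + 2) / (real M + 1)"
  have "cmean (\<lambda>z. kern M (z * cnj y) * (cmod (z - y))\<^sup>2) =
     cmean (\<lambda>z. 4 * kern M (z * cnj y) + (- ?r) * kern (Suc M) (z * cnj y))"
    by (rule cmean_cong) (simp only: kern_dist[OF _ y] mult_minus_left add_uminus_conv_diff)
  also have "\<dots> = 4 * cmean (\<lambda>z. kern M (z * cnj y)) + (- ?r) * cmean (\<lambda>z. kern (Suc M) (z * cnj y))"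
    by (subst cmean_add) (intro continuous_intros, intro continuous_intros, simp only: cmean_linear[OF bounded_linear_mult_right kern_continuous])
  also have "\<dots> = 4 - ?r" by (simp add: cmean_kern[OF y])
  finally show ?thesis by (simp only: kern_variance_eq)
qed

text \<open>A polynomial whose squared modulus on the circle is the kernel centred at \<open>y\<close>.\<close>

definition peak :: "nat \<Rightarrow> complex \<Rightarrow> complex poly" where
  "peak M y = smult (of_real (sqrt (4 ^ M / (2 * M choose M)))) ([:1 / 2, cnj y / 2:] ^ M)"

lemma degree_peak: "degree (peak M y) \<le> M"
proof -
  have "degree ([:1 / 2, cnj y / 2:] ^ M) \<le> degree [:1 / 2, cnj y / 2:] * M" by (rule degree_power_le)
  also have "\<dots> \<le> 1 * M" by (intro mult_right_mono) auto
  finally show ?thesis using degree_smult_le order_trans by (fastforce simp: peak_def)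
qed

lemma norm_peak_square:
  assumes "z \<in> circle" "y \<in> circle"
  shows "(cmod (poly (peak M y) z))\<^sup>2 = kern M (z * cnj y)"
proof -
  let ?w = "z * cnj y"
  have "?w * cnj ?w = 1" using circle_mult_cnj[OF assms] complex_norm_square[of ?w] by simp
  hence "complex_of_real ((cmod ((1 + ?w) / 2))\<^sup>2) = of_real ((1 + Re ?w) / 2)"
    unfolding complex_norm_square using complex_add_cnj[of ?w] by (simp add: field_simps)
  hence *: "(cmod ((1 + ?w) / 2))\<^sup>2 = (1 + Re ?w) / 2" by (simp only: of_real_eq_iff)
  have "poly (peak M y) z = of_real (sqrt (4 ^ M / (2 * M choose M))) * ((1 + ?w) / 2) ^ M"
    by (simp add: peak_def poly_power add_divide_distrib)
  hence "(cmod (poly (peak M y) z))\<^sup>2 = (4 ^ M / (2 * M choose M)) * (cmod ((1 + ?w) / 2) ^ M)\<^sup>2"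
    by (simp add: norm_mult norm_power power_mult_distrib del: of_real_divide)
  also have "(cmod ((1 + ?w) / 2) ^ M)\<^sup>2 = ((cmod ((1 + ?w) / 2))\<^sup>2) ^ M"
    by (simp only: mult.commute flip: power_mult)
  finally show ?thesis unfolding * kern_def .
qed

section \<open>Test functions\<close>

lemma norm_vec_le_sum: "norm (x :: complex ^ 'm::finite) \<le> (\<Sum>i\<in>UNIV. norm (x $ i))"
  unfolding norm_vec_def by (rule L2_set_le_sum) simp

lemma opnorm_le_norm: "opnorm (A :: 'm::finite cmat) \<le> real CARD('m) * real CARD('m) * norm A"
proof (rule opnorm_leI)
  fix x
  have "norm (A *v x) \<le> (\<Sum>i\<in>UNIV. norm ((A *v x) $ i))" by (rule norm_vec_le_sum)
  also have "\<dots> \<le> (\<Sum>i\<in>(UNIV::'m set). \<Sum>k\<in>(UNIV::'m set). norm A * norm x)"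
    unfolding mv_nth
  proof (rule sum_mono, rule order_trans[OF norm_sum], rule sum_mono)
    fix i k
    have "norm (A $ i $ k) \<le> norm A"
      by (rule order_trans[OF Finite_Cartesian_Product.norm_nth_le Finite_Cartesian_Product.norm_nth_le])
    thus "norm (A $ i $ k * x $ k) \<le> norm A * norm x"
      unfolding norm_mult by (intro mult_mono Finite_Cartesian_Product.norm_nth_le) auto
  qed
  also have "\<dots> = real CARD('m) * real CARD('m) * norm A * norm x" by simp
  finally show "norm (A *v x) \<le> \<dots>" .
qed

text \<open>Continuity on the compact circle bounds the values, so that the supremum is a genuine one.\<close>

lemma opnorm_le_sup_norm:
  assumes "continuous_on circle f" "z \<in> circle"
  shows "opnorm (f z :: 'm::finite cmat) \<le> sup_norm f"
proof -
  have "bounded (f ` circle)"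
    by (intro compact_imp_bounded compact_continuous_image assms(1)) simp
  then obtain B where "\<forall>A\<in>f ` circle. norm A \<le> B" unfolding bounded_iff by blast
  hence B: "norm (f z) \<le> B" if "z \<in> circle" for z using that by blast
  have "bdd_above ((\<lambda>z. opnorm (f z)) ` circle)"
  proof (rule bdd_aboveI2)
    fix z :: complex assume "z \<in> circle"
    hence "real CARD('m) * real CARD('m) * norm (f z) \<le> real CARD('m) * real CARD('m) * B"
      by (intro mult_left_mono B) auto
    thus "opnorm (f z) \<le> real CARD('m) * real CARD('m) * B"
      by (rule order_trans[OF opnorm_le_norm])
  qed
  thus ?thesis unfolding sup_norm_def using assms(2) by (rule cSUP_upper[rotated])
qed

lemma C1_circle_arc:
  assumes f: "f \<in> C1_circle" and le: "\<And>z. z \<in> circle \<Longrightarrow> opnorm (angular_deriv f z) \<le> 1" and z: "z \<in> circle"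
  shows "opnorm (f (z * cis t) - f z :: 'm::finite cmat) \<le> \<bar>t\<bar>"
proof (rule opnorm_leI)
  fix x
  define g where "g s = f (z * cis s) *v x" for s
  define D where "D s = angular_deriv f (z * cis s) *v x" for s
  have g: "(g has_vector_derivative D s) (at s)" for s
  proof -
    have zs: "z * cis s \<in> circle" using z by (simp add: norm_mult)
    have "((\<lambda>t. f (z * cis s * cis t)) has_vector_derivative angular_deriv f (z * cis s)) (at 0)"
      using f zs unfolding angular_deriv_def C1_circle_def vector_derivative_works[symmetric] by blast
    hence "((\<lambda>t. f (z * cis s * cis t)) \<circ> (\<lambda>u. u - s) has_vector_derivative 1 *\<^sub>R angular_deriv f (z * cis s)) (at s)"
      by (intro vector_diff_chain_at) (auto intro!: derivative_eq_intros)
    moreover have "(\<lambda>t. f (z * cis s * cis t)) \<circ> (\<lambda>u. u - s) = (\<lambda>u. f (z * cis u))"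
      by (auto simp: fun_eq_iff mult.assoc cis_mult)
    ultimately have "((\<lambda>u. f (z * cis u)) has_vector_derivative angular_deriv f (z * cis s)) (at s)" by simp
    from bounded_linear.has_vector_derivative[OF bounded_linear_mv_left this, of x]
    show ?thesis by (simp add: g_def[abs_def] D_def)
  qed
  have "norm (g t - g 0) \<le> norm x * norm (t - 0)"
  proof (rule differentiable_bound[where S = UNIV and f' = "\<lambda>s h. h *\<^sub>R D s"])
    show "(g has_derivative (\<lambda>h. h *\<^sub>R D s)) (at s within UNIV)" for s
      using g[of s] by (simp add: has_vector_derivative_def)
    show "onorm (\<lambda>h. h *\<^sub>R D s) \<le> norm x" for s
    proof (rule onorm_le)
      fix h :: real
      have "norm (D s) \<le> opnorm (angular_deriv f (z * cis s)) * norm x" unfolding D_def by (rule norm_mv_le)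
      also have "\<dots> \<le> 1 * norm x" using z by (intro mult_right_mono le) (auto simp: norm_mult)
      finally show "norm (h *\<^sub>R D s) \<le> norm x * norm h" by (simp add: mult.commute mult_left_mono)
    qed
  qed auto
  thus "norm ((f (z * cis t) - f z) *v x) \<le> \<bar>t\<bar> * norm x"
    by (simp add: g_def matrix_vector_mult_diff_rdistrib mult.commute)
qed

text \<open>From \<open>cos t \<le> 1 - t\<^sup>2 / 2 + t\<^sup>4 / 24\<close> and \<open>t\<^sup>2 \<le> \<pi>\<^sup>2 < 10\<close>; the constant is not optimal.\<close>

lemma arc_le_chord:
  assumes "\<bar>t\<bar> \<le> pi" shows "\<bar>t\<bar> \<le> 3 * cmod (cis t - 1)"
proof -
  obtain u where u: "cos t = (\<Sum>m<4. cos_coeff m * t ^ m) + cos (u + 1 / 2 * real 4 * pi) / fact 4 * t ^ 4"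
    using Maclaurin_cos_expansion[of t 4] by auto
  have "cos t = 1 - t\<^sup>2 / 2 + cos (u + 2 * pi) / 24 * t ^ 4"
  proof -
    have 4: "{..<4} = {0, 1, 2, 3::nat}" by auto
    show ?thesis unfolding u 4 by (simp add: cos_coeff_def fact_numeral)
  qed
  also have "\<dots> \<le> 1 - t\<^sup>2 / 2 + 1 / 24 * t ^ 4"
    by (intro add_left_mono mult_right_mono divide_right_mono cos_le_one) auto
  finally have 1: "t\<^sup>2 - t ^ 4 / 12 \<le> 2 - 2 * cos t" by simp
  have "t\<^sup>2 \<le> pi\<^sup>2" using assms abs_le_square_iff[of t pi] by simp
  also have "\<dots> \<le> 3.15\<^sup>2" using pi_approx by (intro power_mono) auto
  finally have "t\<^sup>2 * t\<^sup>2 \<le> 10 * t\<^sup>2" by (intro mult_right_mono) (auto simp: power2_eq_square)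
  hence "t ^ 4 \<le> 10 * t\<^sup>2" by (simp flip: power_add)
  with 1 have "t\<^sup>2 \<le> 6 * (2 - 2 * cos t)" by argo
  also have "2 - 2 * cos t = (cmod (cis t - 1))\<^sup>2"
    using sin_cos_squared_add[of t] by (simp add: cmod_def power2_eq_square algebra_simps)
  also have "6 * \<dots> \<le> (3 * cmod (cis t - 1))\<^sup>2" by (simp add: power_mult_distrib)
  finally have "\<bar>t\<bar> \<le> \<bar>3 * cmod (cis t - 1)\<bar>" by (simp only: abs_le_square_iff)
  thus ?thesis by simp
qed

text \<open>The bound on the angular derivative gives the Lipschitz estimate, this gives continuity, and only
  then can pointwise bounds be read off from \<open>sup_norm f\<close>.\<close>

lemma test_function_bounds:
  assumes f: "f \<in> test_functions"
  shows test_function_lipschitz: "z \<in> circle \<Longrightarrow> w \<in> circle \<Longrightarrow> opnorm (f z - f w :: 'm::finite cmat) \<le> 3 * cmod (z - w)"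
    and test_function_continuous: "continuous_on circle f"
    and test_function_le_1: "z \<in> circle \<Longrightarrow> opnorm (f z) \<le> 1"
proof -
  have f': "f \<in> C1_circle" "sup_norm f \<le> 1" "sup_norm (angular_deriv f) \<le> 1"
    using f by (auto simp: test_functions_def)
  have D: "opnorm (angular_deriv f z) \<le> 1" if "z \<in> circle" for z
    using opnorm_le_sup_norm[of "angular_deriv f" z] f' that by (auto simp: C1_circle_def)
  show lip: "opnorm (f z - f w) \<le> 3 * cmod (z - w)" if zw: "z \<in> circle" "w \<in> circle" for z w
  proof -
    define t where "t = Arg (z / w)"
    have "z / w \<noteq> 0" "cmod (z / w) = 1" using zw by (auto simp: norm_divide)
    hence c: "cis t = z / w" by (simp add: t_def cis_Arg sgn_div_norm)
    have "z = w * cis t" using zw circle_nz[of w] by (simp add: c)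
    hence "opnorm (f z - f w) \<le> \<bar>t\<bar>" using C1_circle_arc[OF f'(1) D zw(2), of t] by simp
    also have "\<dots> \<le> 3 * cmod (cis t - 1)"
      by (rule arc_le_chord) (use Arg_bounded[of "z / w"] in \<open>auto simp: t_def\<close>)
    also have "cmod (cis t - 1) = cmod (w * (cis t - 1))" using zw by (simp add: norm_mult)
    also have "w * (cis t - 1) = z - w" using \<open>z = w * cis t\<close> by (simp add: algebra_simps)
    finally show ?thesis .
  qed
  show cont: "continuous_on circle f"
  proof (rule continuous_on_matI)
    fix i j
    have "3-lipschitz_on circle (\<lambda>z. f z $ i $ j)"
    proof (rule lipschitz_onI)
      fix x y :: complex assume "x \<in> circle" "y \<in> circle"
      from lip[OF this] norm_nth_nth_le_opnorm[of "f x - f y" i j]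
      show "dist (f x $ i $ j) (f y $ i $ j) \<le> 3 * dist x y" by (simp add: dist_norm)
    qed simp
    thus "continuous_on circle (\<lambda>z. f z $ i $ j)" by (rule lipschitz_on_continuous_on)
  qed
  show "opnorm (f z) \<le> 1" if "z \<in> circle"
    using opnorm_le_sup_norm[OF cont that] f' by simp
qed

section \<open>Smoothing by sampling at roots of unity\<close>

text \<open>\<open>M + 2\<close> nodes suffice to integrate exactly the kernels of degree \<open>M\<close> and \<open>M + 1\<close>, both of which enter
  the variance. The weights below form a partition of unity on the circle.\<close>

definition node :: "nat \<Rightarrow> nat \<Rightarrow> complex" where
  "node M j = rootpt (M + 2) j"

definition weight :: "nat \<Rightarrow> nat \<Rightarrow> complex \<Rightarrow> real" where
  "weight M j z = kern M (z * cnj (node M j)) / (M + 2)"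

lemma node_circle [simp]: "node M j \<in> circle"
  unfolding node_def by (rule rootpt_circle)

lemma weight_nonneg: "z \<in> circle \<Longrightarrow> 0 \<le> weight M j z"
  using kern_nonneg[OF circle_mult_cnj[OF _ node_circle]] by (simp add: weight_def)

lemma weight_continuous [continuous_intros]: "continuous_on S (weight M j)"
proof -
  have "continuous_on S (\<lambda>z. weight M j z)"
    unfolding weight_def by (intro continuous_intros) auto
  thus ?thesis by simp
qed

lemma sum_weight: "z \<in> circle \<Longrightarrow> (\<Sum>j<M+2. weight M j z) = 1"
  using sum_kern_rootpt[of z M "M + 2"] by (simp only: weight_def node_def)

lemma sum_weight_dist: "z \<in> circle \<Longrightarrow> (\<Sum>j<M+2. weight M j z * (cmod (z - node M j))\<^sup>2) = 2 / (real M + 1)"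
  using sum_kern_dist[of z M "M + 2"] by (simp only: weight_def node_def)

lemma sum_weight_matrices_le:
  assumes "z \<in> circle" "\<And>j. opnorm (A j) \<le> d"
  shows "opnorm (\<Sum>j<M+2. cscale (of_real (weight M j z)) (A j)) \<le> d"
proof -
  have "opnorm (\<Sum>j<M+2. cscale (of_real (weight M j z)) (A j)) \<le> (\<Sum>j<M+2. weight M j z * d)"
  proof (rule order_trans[OF opnorm_sum_le], rule sum_mono)
    fix j
    have "opnorm (cscale (of_real (weight M j z)) (A j)) \<le> weight M j z * opnorm (A j)"
      using opnorm_cscale_le[of "of_real (weight M j z)" "A j"] weight_nonneg[OF assms(1), of M j] by simp
    also have "\<dots> \<le> weight M j z * d" by (intro mult_left_mono assms weight_nonneg)
    finally show "opnorm (cscale (of_real (weight M j z)) (A j)) \<le> weight M j z * d" .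
  qed
  also have "\<dots> = d" using sum_weight[OF assms(1), of M] by (simp only: sum_distrib_right[symmetric] mult_1_left)
  finally show ?thesis .
qed

definition smooth :: "nat \<Rightarrow> (complex \<Rightarrow> 'm::finite cmat) \<Rightarrow> complex \<Rightarrow> 'm cmat" where
  "smooth M f z = (\<Sum>j<M+2. cscale (of_real (weight M j z)) (f (node M j)))"

lemma trig_mat_smooth: "trig_mat M (smooth M f)"
  unfolding trig_mat_def
proof (intro allI)
  fix k l
  have "trig_poly M (\<lambda>z. \<Sum>j<M+2. (f (node M j) $ k $ l / (M + 2)) * of_real (kern M (z * cnj (node M j))))"
    by (intro trig_poly_sum trig_poly.scale trig_poly_kern node_circle)
  thus "trig_poly M (\<lambda>z. smooth M f z $ k $ l)" by (simp add: smooth_def weight_def mult.commute)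
qed

lemma smooth_le_1:
  assumes "f \<in> test_functions" "z \<in> circle"
  shows "opnorm (smooth M f z) \<le> 1"
  unfolding smooth_def by (intro sum_weight_matrices_le assms test_function_le_1 node_circle)

lemma le_add_square_div:
  fixes d r :: real assumes "r > 0" "d \<ge> 0" shows "d \<le> r + d\<^sup>2 / r"
proof (cases "d \<le> r")
  case False
  hence "d * r \<le> d * d" using assms by (intro mult_left_mono) auto
  hence "d \<le> d\<^sup>2 / r" using assms by (simp add: le_divide_eq power2_eq_square)
  thus ?thesis using assms by simp
next
  case True
  have "0 \<le> d\<^sup>2 / r" using assms by simp
  with True show ?thesis by linarith
qed

text \<open>The width of the kernel, up to a constant: its square is proportional to the variance.\<close>

definition rad :: "nat \<Rightarrow> real" where
  "rad M = 1 / sqrt (real M + 1)"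

lemma rad_pos: "rad M > 0"
  by (simp add: rad_def)

lemma rad_var: "2 / (real M + 1) / rad M = 2 * rad M"
  by (simp add: rad_def real_div_sqrt field_simps flip: real_sqrt_mult)

text \<open>The weighted mean of the distance \<open>d\<close> to the nodes is controlled by its variance through
  \<open>d \<le> r + d\<^sup>2 / r\<close>, with \<open>r\<close> of the order of the standard deviation.\<close>

lemma smooth_approx:
  assumes f: "f \<in> test_functions" and z: "z \<in> circle"
  shows "opnorm (f z - smooth M f z) \<le> 9 * rad M"
proof -
  let ?w = "\<lambda>j. weight M j z" and ?y = "node M" and ?r = "rad M"
  have "f z = cscale (of_real (\<Sum>j<M+2. ?w j)) (f z)" unfolding sum_weight[OF z] by simp
  hence "f z - smooth M f z = (\<Sum>j<M+2. cscale (of_real (?w j)) (f z - f (?y j)))"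
    unfolding smooth_def of_real_sum cscale_sum_left cscale_diff sum_subtractf by simp
  also have "opnorm \<dots> \<le> (\<Sum>j<M+2. 3 * ?r * ?w j + 3 / ?r * (?w j * (cmod (z - ?y j))\<^sup>2))"
  proof (rule order_trans[OF opnorm_sum_le], rule sum_mono)
    fix j
    have "opnorm (cscale (of_real (?w j)) (f z - f (?y j))) \<le> ?w j * opnorm (f z - f (?y j))"
      using opnorm_cscale_le[of "of_real (?w j)" "f z - f (?y j)"] weight_nonneg[OF z, of M j] by simp
    also have "\<dots> \<le> ?w j * (3 * (?r + (cmod (z - ?y j))\<^sup>2 / ?r))"
    proof (intro mult_left_mono weight_nonneg z)
      have "opnorm (f z - f (?y j)) \<le> 3 * cmod (z - ?y j)" by (intro test_function_lipschitz f z node_circle)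
      also have "\<dots> \<le> 3 * (?r + (cmod (z - ?y j))\<^sup>2 / ?r)"
        by (intro mult_left_mono le_add_square_div rad_pos) auto
      finally show "opnorm (f z - f (?y j)) \<le> \<dots>" .
    qed
    also have "\<dots> = 3 * ?r * ?w j + 3 / ?r * (?w j * (cmod (z - ?y j))\<^sup>2)" by (simp add: algebra_simps)
    finally show "opnorm (cscale (of_real (?w j)) (f z - f (?y j))) \<le> \<dots>" .
  qed
  also have "\<dots> = 3 * ?r + 3 * (2 / (real M + 1) / ?r)"
    by (simp only: sum.distrib sum_distrib_left[symmetric] sum_weight[OF z] sum_weight_dist[OF z]) simp
  also have "\<dots> = 9 * ?r" unfolding rad_var by simp
  finally show ?thesis .
qed

section \<open>Approximating a unital completely positive map\<close>

lemma opnorm_cmean_le: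
  assumes "continuous_on circle F" "continuous_on circle g"
    "\<And>z. z \<in> circle \<Longrightarrow> opnorm (F z) \<le> g z"
  shows "opnorm (cmean F :: 'm::finite cmat) \<le> cmean g"
proof (rule opnorm_leI)
  fix x
  have "cmean F *v x = cmean (\<lambda>z. F z *v x)"
    by (rule cmean_linear[symmetric, OF bounded_linear_mv_left assms(1)])
  also have "norm \<dots> \<le> cmean (\<lambda>z. g z * norm x)"
  proof (rule norm_cmean_le)
    show "continuous_on circle (\<lambda>z. F z *v x)"
      by (rule bounded_linear.continuous_on[OF bounded_linear_mv_left assms(1)])
    show "continuous_on circle (\<lambda>z. g z * norm x)" by (intro continuous_intros assms)
    show "norm (F z *v x) \<le> g z * norm x" if "z \<in> circle" for z
      using norm_mv_le[of "F z" x] assms(3)[OF that] by (meson mult_right_mono norm_ge_zero order_trans)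
  qed
  also have "\<dots> = cmean g * norm x"
    by (rule cmean_linear[OF bounded_linear_mult_left assms(2)])
  finally show "norm (cmean F *v x) \<le> cmean g * norm x" .
qed

lemma bounded_linear_conj: "bounded_linear (\<lambda>A. (B :: 'm::finite cmat) ** A ** (C :: 'm cmat))"
proof -
  have "linear (\<lambda>A. B ** A ** C)"
  proof (rule linearI)
    show "B ** (A1 + A2) ** C = B ** A1 ** C + B ** A2 ** C" for A1 A2 :: "'m cmat"
      by (simp add: matrix_add_ldistrib mm_add_left)
    show "B ** (r *\<^sub>R A) ** C = r *\<^sub>R (B ** A ** C)" for r and A :: "'m cmat"
      unfolding cscale_of_real[symmetric] cscale_mm_left cscale_mm_right ..
  qed
  thus ?thesis by (simp add: linear_conv_bounded_linear)
qed

lemma cmean_real_cscale: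
  assumes "continuous_on circle g"
  shows "cmean (\<lambda>z. cscale (of_real (g z)) A) = cscale (of_real (cmean g)) (A :: 'm::finite cmat)"
  unfolding cscale_of_real by (rule cmean_linear[OF bounded_linear_scaleR_left assms])

lemma sandwich_peak:
  assumes y: "y \<in> circle" and G: "continuous_on circle G"
  shows "sandwich (\<lambda>z. cscale (poly (peak M y) z) K) G =
    adj K ** cmean (\<lambda>z. cscale (of_real (kern M (z * cnj y))) (G z)) ** (K :: 'm::finite cmat)"
proof -
  have "sandwich (\<lambda>z. cscale (poly (peak M y) z) K) G =
     cmean (\<lambda>z. adj K ** cscale (of_real (kern M (z * cnj y))) (G z) ** K)"
    unfolding sandwich_def
  proof (rule cmean_cong)
    fix z :: complex assume z: "z \<in> circle"
    have "complex_of_real (kern M (z * cnj y)) = poly (peak M y) z * cnj (poly (peak M y) z)"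
      unfolding norm_peak_square[OF z y, symmetric] by (rule complex_norm_square)
    thus "adj (cscale (poly (peak M y) z) K) ** G z ** cscale (poly (peak M y) z) K
       = adj K ** cscale (of_real (kern M (z * cnj y))) (G z) ** K"
      by (simp add: adj_cscale cscale_mm_left cscale_mm_right cscale_cscale)
  qed
  also have "\<dots> = adj K ** cmean (\<lambda>z. cscale (of_real (kern M (z * cnj y))) (G z)) ** K"
    by (intro cmean_linear bounded_linear_conj continuous_intros G)
  finally show ?thesis .
qed

lemma peak_mean_approx:
  fixes f :: "complex \<Rightarrow> 'm::finite cmat"
  assumes f: "f \<in> test_functions" and y: "y \<in> circle"
  shows "opnorm (f y - cmean (\<lambda>z. cscale (of_real (kern M (z * cnj y))) (smooth M f z))) \<le> 18 * rad M"
proof -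
  let ?k = "\<lambda>z. kern M (z * cnj y)" and ?r = "rad M"
  have sc: "continuous_on circle (smooth M f)" by (rule trig_mat_continuous[OF trig_mat_smooth])
  have "f y = cmean (\<lambda>z. cscale (of_real (?k z)) (f y))"
    by (subst cmean_real_cscale) (auto intro!: continuous_intros simp: cmean_kern[OF y])
  hence "cmean (\<lambda>z. cscale (of_real (?k z)) (smooth M f z - f y)) = cmean (\<lambda>z. cscale (of_real (?k z)) (smooth M f z)) - f y"
    unfolding cscale_diff by (subst cmean_diff) (intro continuous_intros sc, intro continuous_intros, simp)
  hence "opnorm (f y - cmean (\<lambda>z. cscale (of_real (?k z)) (smooth M f z))) = opnorm (cmean (\<lambda>z. cscale (of_real (?k z)) (smooth M f z - f y)))"
    by (simp add: opnorm_minus)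
  also have "\<dots> \<le> cmean (\<lambda>z. 12 * ?r * ?k z + 3 / ?r * (?k z * (cmod (z - y))\<^sup>2))"
  proof (rule opnorm_cmean_le)
    show "continuous_on circle (\<lambda>z. cscale (of_real (?k z)) (smooth M f z - f y))"
      by (intro continuous_intros sc)
    show "continuous_on circle (\<lambda>z. 12 * ?r * ?k z + 3 / ?r * (?k z * (cmod (z - y))\<^sup>2))"
      by (intro continuous_intros)
    fix z :: complex assume z: "z \<in> circle"
    have k: "?k z \<ge> 0" by (rule kern_nonneg[OF circle_mult_cnj[OF z y]])
    have "opnorm (smooth M f z - f y) \<le> opnorm (smooth M f z - f z) + opnorm (f z - f y)"
      using opnorm_triangle[of "smooth M f z - f z" "f z - f y"] by simp
    also have "opnorm (smooth M f z - f z) \<le> 9 * ?r"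
      using smooth_approx[OF f z] by (simp add: opnorm_minus)
    also have "opnorm (f z - f y) \<le> 3 * cmod (z - y)" by (rule test_function_lipschitz[OF f z y])
    also have "cmod (z - y) \<le> ?r + (cmod (z - y))\<^sup>2 / ?r" by (intro le_add_square_div rad_pos norm_ge_zero)
    finally have *: "opnorm (smooth M f z - f y) \<le> 12 * ?r + 3 / ?r * (cmod (z - y))\<^sup>2" by (simp add: algebra_simps)
    have "opnorm (cscale (of_real (?k z)) (smooth M f z - f y)) \<le> ?k z * opnorm (smooth M f z - f y)"
      using opnorm_cscale_le[of "of_real (?k z)" "smooth M f z - f y"] k by simp
    also have "\<dots> \<le> ?k z * (12 * ?r + 3 / ?r * (cmod (z - y))\<^sup>2)" by (rule mult_left_mono[OF * k])
    also have "\<dots> = 12 * ?r * ?k z + 3 / ?r * (?k z * (cmod (z - y))\<^sup>2)" by (simp add: algebra_simps)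
    finally show "opnorm (cscale (of_real (?k z)) (smooth M f z - f y)) \<le> \<dots>" .
  qed
  also have "\<dots> = 12 * ?r * cmean ?k + 3 / ?r * cmean (\<lambda>z. ?k z * (cmod (z - y))\<^sup>2)"
  proof -
    have c: "continuous_on circle ?k" "continuous_on circle (\<lambda>z. ?k z * (cmod (z - y))\<^sup>2)"
      by (intro continuous_intros)+
    show ?thesis
      by (subst cmean_add) (intro continuous_on_mult continuous_on_const c, intro continuous_on_mult continuous_on_const c,
         simp only: cmean_linear[OF bounded_linear_mult_right c(1)] cmean_linear[OF bounded_linear_mult_right c(2)])
  qed
  also have "\<dots> = 12 * ?r + 3 * (2 / (real M + 1) / ?r)"
    unfolding cmean_kern[OF y] cmean_kern_dist[OF y] by simp
  also have "\<dots> = 18 * ?r" unfolding rad_var by simp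
  finally show ?thesis .
qed

text \<open>The map \<open>\<phi>\<close> is close to \<open>\<phi> \<circ> smooth M\<close>, which only sees the values \<open>f (node M j)\<close> and is the sum of
  \<open>K\<^sup>* f (node M j) K\<close> over the Kraus operators \<open>K\<close> of \<open>A \<mapsto> \<phi> (weight M j A)\<close>. Replace \<open>K\<close> by its product
  with the peak polynomial at the node and separate these blocks by powers of \<open>z\<close>. On smoothed functions
  this replaces \<open>f (node M j)\<close> by a mean concentrated at that node, and the total change is \<open>\<phi>\<close> applied to a small
  function. The normalisation is exact, and the degree bound does not depend on \<open>\<phi>\<close>.\<close>

lemma ucp_approx:
  fixes M :: nat
  shows "\<exists>N. \<forall>\<phi>\<in>ucp. \<exists>P. poly_mat N P \<and> sandwich P (\<lambda>z. mat 1) = mat 1 \<and>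
    (\<forall>f\<in>test_functions. opnorm (\<phi> f - sandwich P (smooth M f) :: 'm::finite cmat) \<le> 27 * rad M)"
proof -
  define I where "I = {..<M+2} \<times> (UNIV :: ('m \<times> 'm) set)"
  have fin: "finite I" by (simp add: I_def)
  obtain e where e: "bij_betw e I {0..<card I}" using ex_bij_betw_finite_nat[OF fin] by blast
  \<comment> \<open>The enumeration \<open>e\<close> spaces the blocks, of degree at most \<open>M\<close>, at distance more than \<open>M + M\<close>.\<close>
  define k where "k t = (2 * M + 1) * e t" for t
  define N where "N = (2 * M + 1) * card I + M"
  show ?thesis
  proof (intro exI[of _ N] ballI)
    fix \<phi> :: "(complex \<Rightarrow> 'm cmat) \<Rightarrow> 'm cmat" assume \<phi>: "\<phi> \<in> ucp"
    have "\<exists>K :: 'm \<times> 'm \<Rightarrow> 'm cmat. \<forall>A. \<phi> (\<lambda>z. cscale (of_real (weight M j z)) A) = (\<Sum>s\<in>UNIV. adj (K s) ** A ** K s)" for j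
      by (intro ucp_kraus \<phi> weight_continuous weight_nonneg)
    hence "\<forall>j. \<exists>K :: 'm \<times> 'm \<Rightarrow> 'm cmat. \<forall>A. \<phi> (\<lambda>z. cscale (of_real (weight M j z)) A) = (\<Sum>s\<in>UNIV. adj (K s) ** A ** K s)"
      by blast
    from choice[OF this] obtain K :: "nat \<Rightarrow> 'm \<times> 'm \<Rightarrow> 'm cmat" where
      K: "\<And>j A. \<phi> (\<lambda>z. cscale (of_real (weight M j z)) A) = (\<Sum>s\<in>UNIV. adj (K j s) ** A ** K j s)"
      by blast
    have \<phi>sum: "\<phi> (\<lambda>z. \<Sum>j<M+2. cscale (of_real (weight M j z)) (A j)) = (\<Sum>(j, s)\<in>I. adj (K j s) ** A j ** K j s)" for A
      by (subst ucp_sum[OF \<phi>]) (auto intro!: continuous_intros simp: K I_def sum.cartesian_product)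
    define R where "R = (\<lambda>(j, s) z. cscale (poly (peak M (node M j)) z) (K j s))"
    define P where "P z = (\<Sum>t\<in>I. cscale (z ^ k t) (R t z))" for z
    have R: "poly_mat M (R t)" for t
      using poly_mat_scale_poly[OF poly_mat_const[of 0] degree_peak] by (cases t) (simp add: R_def)
    have sep: "int (M + M) < \<bar>int (k t) - int (k s)\<bar>" if "s \<in> I" "t \<in> I" "s \<noteq> t" for s t
    proof -
      have "e s \<noteq> e t" using that e by (auto simp: bij_betw_def inj_on_def)
      have "int (k t) - int (k s) = int (2 * M + 1) * (int (e t) - int (e s))"
        by (simp add: k_def algebra_simps)
      hence "\<bar>int (k t) - int (k s)\<bar> = int (2 * M + 1) * \<bar>int (e t) - int (e s)\<bar>"
        by (simp add: abs_mult)
      moreover have "int (2 * M + 1) * 1 \<le> int (2 * M + 1) * \<bar>int (e t) - int (e s)\<bar>"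
        using \<open>e s \<noteq> e t\<close> by (intro mult_left_mono) auto
      ultimately have "int (2 * M + 1) \<le> \<bar>int (k t) - int (k s)\<bar>" by (simp only: mult_1_right)
      thus ?thesis by simp
    qed
    have P: "poly_mat N P"
      unfolding P_def
    proof (rule poly_mat_sum)
      fix t assume "t \<in> I"
      hence "e t < card I" using e by (auto simp: bij_betw_def)
      hence "k t + M \<le> N" by (simp add: k_def N_def del: mult_Suc)
      thus "poly_mat N (\<lambda>z. cscale (z ^ k t) (R t z))"
        by (rule poly_mat_mono[OF poly_mat_shift[OF R]])
    qed
    let ?B = "\<lambda>G j. cmean (\<lambda>z. cscale (of_real (kern M (z * cnj (node M j)))) (G z))"
    have S: "sandwich P G = \<phi> (\<lambda>z. \<Sum>j<M+2. cscale (of_real (weight M j z)) (?B G j))" if G: "trig_mat M G" for G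
    proof -
      have "sandwich P G = (\<Sum>t\<in>I. sandwich (R t) G)"
        unfolding P_def by (rule sandwich_blocks[OF fin R G sep])
      also have "\<dots> = (\<Sum>(j, s)\<in>I. adj (K j s) ** ?B G j ** K j s)"
        by (intro sum.cong refl) (auto simp: R_def intro!: sandwich_peak trig_mat_continuous[OF G] node_circle simp del: mem_sphere_0)
      also have "\<dots> = \<phi> (\<lambda>z. \<Sum>j<M+2. cscale (of_real (weight M j z)) (?B G j))" by (rule \<phi>sum[symmetric])
      finally show ?thesis .
    qed
    have cw: "continuous_on circle (\<lambda>z. \<Sum>j<M+2. cscale (of_real (weight M j z)) (A j))" for A :: "nat \<Rightarrow> 'm cmat"
      by (intro continuous_intros)
    have "?B (\<lambda>z. mat 1) j = (mat 1 :: 'm cmat)" for j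
      by (subst cmean_real_cscale) (auto intro!: continuous_intros simp: cmean_kern[OF node_circle])
    hence "sandwich P (\<lambda>z. mat 1) = \<phi> (\<lambda>z. \<Sum>j<M+2. cscale (of_real (weight M j z)) (mat 1))"
      by (simp add: S trig_mat_const)
    also have "\<dots> = \<phi> (\<lambda>z. mat 1)"
    proof (rule ucp_cong[OF \<phi> cw continuous_on_const])
      fix z :: complex assume "z \<in> circle"
      from sum_weight[OF this, of M] show "(\<Sum>j<M+2. cscale (of_real (weight M j z)) (mat 1)) = (mat 1 :: 'm cmat)"
        by (simp only: cscale_sum_left[symmetric] of_real_sum[symmetric]) simp
    qed
    finally have one: "sandwich P (\<lambda>z. mat 1) = mat 1" using ucp_one[OF \<phi>] by simp
    have "opnorm (\<phi> f - sandwich P (smooth M f)) \<le> 27 * rad M" if f: "f \<in> test_functions" for f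
    proof -
      have cf: "continuous_on circle f" "continuous_on circle (smooth M f)"
        by (rule test_function_continuous[OF f], rule trig_mat_continuous[OF trig_mat_smooth])
      have "opnorm (\<phi> (\<lambda>z. f z - smooth M f z)) \<le> 9 * rad M"
        by (rule ucp_contractive[OF \<phi> continuous_on_diff[OF cf] _ smooth_approx[OF f]]) (simp add: rad_pos)
      hence 1: "opnorm (\<phi> f - \<phi> (smooth M f)) \<le> 9 * rad M"
        unfolding ucp_diff[OF \<phi> cf] .
      have sm: "smooth M f = (\<lambda>z. \<Sum>j<M+2. cscale (of_real (weight M j z)) (f (node M j)))"
        by (simp only: smooth_def[abs_def])
      have "\<phi> (smooth M f) - sandwich P (smooth M f) =
         \<phi> (\<lambda>z. \<Sum>j<M+2. cscale (of_real (weight M j z)) (f (node M j) - ?B (smooth M f) j))"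
        unfolding S[OF trig_mat_smooth] unfolding cscale_diff sum_subtractf ucp_diff[OF \<phi> cw cw] sm[symmetric] ..
      also have "opnorm \<dots> \<le> 18 * rad M"
        by (rule ucp_contractive[OF \<phi> cw _ sum_weight_matrices_le[OF _ peak_mean_approx[OF f node_circle]]]) (simp_all add: rad_pos)
      finally have "opnorm (\<phi> (smooth M f) - sandwich P (smooth M f)) \<le> 18 * rad M" .
      with 1 opnorm_triangle[of "\<phi> f - \<phi> (smooth M f)" "\<phi> (smooth M f) - sandwich P (smooth M f)"]
      show ?thesis by simp
    qed
    with P one show "\<exists>P. poly_mat N P \<and> sandwich P (\<lambda>z. mat 1) = mat 1 \<and>
      (\<forall>f\<in>test_functions. opnorm (\<phi> f - sandwich P (smooth M f)) \<le> 27 * rad M)" by blast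
  qed
qed

section \<open>Regularisation\<close>

lemma poly_eq_sum_lessThan: "degree p < n \<Longrightarrow> poly p (z::complex) = (\<Sum>k<n. coeff p k * z ^ k)"
  unfolding poly_altdef by (rule sum.mono_neutral_left) (auto simp: coeff_eq_0)

text \<open>The index is reversed because \<open>Q_fun n V\<close> pairs \<open>V i\<close> with the power \<open>n - i\<close>.\<close>

definition coeff_mat :: "nat \<Rightarrow> ('m \<Rightarrow> 'm \<Rightarrow> complex poly) \<Rightarrow> nat \<Rightarrow> 'm::finite cmat" where
  "coeff_mat n R i = (\<chi> a b. coeff (R a b) (n - i))"

lemma Q_fun_coeff_mat:
  assumes "\<And>a b. degree (R a b) < n"
  shows "Q_fun n (coeff_mat n R) z = (\<chi> a b. poly (R a b) z)"
proof -
  have "Q_fun n (coeff_mat n R) z $ a $ b = poly (R a b) z" for a b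
  proof -
    have "Q_fun n (coeff_mat n R) z $ a $ b = (\<Sum>i=1..n. z ^ (n - i) * coeff (R a b) (n - i))"
      by (simp add: Q_fun_def coeff_mat_def)
    also have "\<dots> = (\<Sum>k<n. coeff (R a b) k * z ^ k)"
      by (rule sum.reindex_bij_witness[of _ "\<lambda>k. n - k" "\<lambda>i. n - i"]) auto
    finally show ?thesis using poly_eq_sum_lessThan[OF assms] by simp
  qed
  thus ?thesis by (simp add: mat_eq_iff)
qed

lemma degree_Q_poly:
  assumes "V 1 \<noteq> 0" "0 < n"
  shows "degree (Q_poly n V) = n - 1"
proof (rule antisym)
  show "degree (Q_poly n V) \<le> n - 1"
    unfolding Q_poly_def by (intro degree_sum_le) (auto intro!: order_trans[OF degree_monom_le])
  have "coeff (Q_poly n V) (n - 1) = (\<Sum>i=1..n. if i = 1 then V i else 0)"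
    unfolding Q_poly_def coeff_sum by (intro sum.cong refl) auto
  also have "\<dots> = V 1" using assms(2) by simp
  finally show "n - 1 \<le> degree (Q_poly n V)" using assms(1) by (intro le_degree) simp
qed

lemma adj_mat_1: "adj (mat 1 :: 'm::finite cmat) = mat 1"
  by (auto simp: mat_eq_iff mat_def)

lemma sandwich_const: "sandwich (\<lambda>z. A) (\<lambda>z. mat 1) = adj A ** (A :: 'm::finite cmat)"
  by (simp add: sandwich_def)

lemma sandwich_Q_fun_one:
  "sandwich (Q_fun n V) (\<lambda>z. mat 1) = (\<Sum>i=1..n. adj (V i) ** (V i :: 'm::finite cmat))"
proof -
  have "sandwich (Q_fun n V) (\<lambda>z. mat 1) = sandwich (\<lambda>z. \<Sum>i=1..n. cscale (z ^ (n - i)) (V i)) (\<lambda>z. mat 1)"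
    by (simp add: Q_fun_def[abs_def])
  also have "\<dots> = (\<Sum>i=1..n. sandwich (\<lambda>z. V i) (\<lambda>z. mat 1))"
    by (rule sandwich_blocks[where M = 0 and N = 0]) (auto intro: poly_mat_const trig_mat_const)
  finally show ?thesis by (simp add: sandwich_const)
qed

text \<open>The isometry condition on the coefficients and the normalisation of the integral are equivalent, by
  Parseval's identity \<open>sandwich_Q_fun_one\<close>.\<close>

lemma Phi_in_B_maps:
  fixes V :: "nat \<Rightarrow> 'm::finite cmat"
  assumes "sandwich (Q_fun n V) (\<lambda>z. mat 1) = mat 1" "regular n V" "V 1 \<noteq> 0" "0 < n"
  shows "Phi n V \<in> B_maps n"
proof -
  have "circle_integral (\<lambda>z. adj (Q_fun n V z) ** Q_fun n V z) = mat 1"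
    using assms(1) by (simp add: sandwich_def circle_integral_eq_cmean)
  thus ?thesis
    using Phi_ucp[OF assms(1)] degree_Q_poly[of V, OF assms(3,4)] assms(1,2)
    by (auto simp: B_maps_def block_isometry_def sandwich_Q_fun_one)
qed

lemma poly_mat_polys:
  assumes "poly_mat N (P :: complex \<Rightarrow> 'm::finite cmat)"
  obtains p where "\<And>a b. degree (p a b) \<le> N" "\<And>z a b. P z $ a $ b = poly (p a b) z"
proof -
  have "\<forall>a. \<exists>q. \<forall>b. degree (q b) \<le> N \<and> (\<forall>z. P z $ a $ b = poly (q b) z)"
    using assms unfolding poly_mat_def by (intro allI choice) blast
  from choice[OF this] show ?thesis using that by blast
qed

lemma opnorm_sandwich_le:
  assumes P: "poly_mat N P" "sandwich P (\<lambda>z. mat 1) = mat 1"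
    and G: "continuous_on circle G" "\<And>z. z \<in> circle \<Longrightarrow> opnorm (G z) \<le> 1"
  shows "opnorm (sandwich P G :: 'm::finite cmat) \<le> 1"
proof -
  obtain p where p: "\<And>a b. degree (p a b) \<le> N" "\<And>z a b. P z $ a $ b = poly (p a b) z"
    using poly_mat_polys[OF P(1)] by blast
  have eq: "Q_fun (Suc N) (coeff_mat (Suc N) p) = P"
    by (rule ext, subst Q_fun_coeff_mat) (auto simp: p less_Suc_eq_le mat_eq_iff)
  have "opnorm (Phi (Suc N) (coeff_mat (Suc N) p) G) \<le> 1"
    by (rule ucp_contractive[OF Phi_ucp G(1) _ G(2)]) (simp_all add: eq P)
  thus ?thesis by (simp add: Phi_eq_sandwich G eq)
qed

lemma sandwich_cscale_arg:
  assumes "continuous_on circle P" "continuous_on circle G"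
  shows "sandwich (\<lambda>z. cscale a (P z)) G = cscale (of_real ((cmod a)\<^sup>2)) (sandwich P (G :: _ \<Rightarrow> 'm::finite cmat))"
proof -
  have "sandwich (\<lambda>z. cscale a (P z)) G = cmean (\<lambda>z. cscale (a * cnj a) (adj (P z) ** G z ** P z))"
    by (simp add: sandwich_def adj_cscale cscale_mm_left cscale_mm_right cscale_cscale mult.commute)
  also have "\<dots> = cscale (a * cnj a) (sandwich P G)"
    unfolding sandwich_def by (intro cmean_linear bounded_linear_cscale continuous_intros assms)
  finally show ?thesis by (simp only: complex_norm_square)
qed

subsection \<open>Matrices of size at least two\<close>

lemma infinite_circle: "infinite circle"
proof
  assume "finite circle"
  moreover have "cis ` {0..1} \<subseteq> circle" by auto
  ultimately have "finite (cis ` {0..1::real})" by (rule rev_finite_subset)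
  moreover have "inj_on cis {0..1}"
  proof (rule inj_onI)
    fix x y :: real assume xy: "x \<in> {0..1}" "y \<in> {0..1}" "cis x = cis y"
    hence "cos x = cos y" by (simp add: complex_eq_iff)
    thus "x = y" using xy pi_gt3 cos_inj_pi[of x y] by simp
  qed
  ultimately have "finite {0..1::real}" by (rule finite_imageD)
  thus False using infinite_Icc[of "0::real" 1] by simp
qed

text \<open>Take \<open>Q = \<eta> + c z\<^sup>k P + \<eta> u z\<^sup>n\<^sup>-\<^sup>1 U\<close> with \<open>U\<close> a transposition matrix exchanging \<open>i0\<close> and \<open>j0\<close>, with
  \<open>u\<close> on the circle and \<open>c\<^sup>2 = 1 - 2 \<eta>\<^sup>2\<close>. The three blocks do not interact, so the normalisation is
  exact and the change of the map is of order \<open>\<eta>\<^sup>2\<close>. The entry \<open>(i0, i0)\<close> of \<open>Q\<close> does not involve \<open>u\<close>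
  and is nonzero at \<open>0\<close>; at each of its finitely many roots the entry \<open>(i0, j0)\<close> vanishes for at most one
  \<open>u\<close>. For any other \<open>u\<close> the matrix \<open>Q\<close> has no root at all.\<close>

lemma regular_approx_matrix:
  fixes P :: "complex \<Rightarrow> 'm::finite cmat"
  assumes P: "poly_mat N P" "sandwich P (\<lambda>z. mat 1) = mat 1"
    and \<eta>: "0 < \<eta>" "\<eta> \<le> 1 / 2" and n: "2 * (M + N) + 4 \<le> n" and ij: "i0 \<noteq> (j0 :: 'm)"
  shows "\<exists>V. Phi n V \<in> B_maps n \<and> (\<forall>G. trig_mat M G \<longrightarrow> (\<forall>z\<in>circle. opnorm (G z) \<le> 1) \<longrightarrow>
    opnorm (sandwich P G - Phi n V G) \<le> 4 * \<eta>\<^sup>2)"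
proof -
  obtain p where p: "\<And>a b. degree (p a b) \<le> N" "\<And>z a b. P z $ a $ b = poly (p a b) z"
    using poly_mat_polys[OF P(1)] by blast
  define k where "k = M + N + 1"
  define c where "c = sqrt (1 - 2 * \<eta>\<^sup>2)"
  have "\<eta>\<^sup>2 \<le> (1 / 2)\<^sup>2" using \<eta> by (intro power_mono) auto
  hence c2: "c\<^sup>2 = 1 - 2 * \<eta>\<^sup>2" unfolding c_def by (simp add: power2_eq_square)
  define swap where "swap a = (if a = i0 then j0 else if a = j0 then i0 else a)" for a
  define U :: "'m cmat" where "U = (\<chi> a b. if b = swap a then 1 else 0)"
  have swap: "b = swap a \<longleftrightarrow> a = swap b" for a b using ij by (auto simp: swap_def)
  have U: "adj U ** U = mat 1"
  proof -
    have "(adj U ** U) $ a $ b = (mat 1 :: 'm cmat) $ a $ b" for a b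
    proof -
      have "(adj U ** U) $ a $ b = (\<Sum>k\<in>UNIV. if k = swap a then (if b = swap k then 1 else 0) else 0)"
        unfolding mm_nth by (intro sum.cong refl) (auto simp: U_def swap[of a])
      thus ?thesis using swap[of "swap a" a] by (auto simp: mat_def swap)
    qed
    thus ?thesis by (simp add: mat_eq_iff)
  qed
  \<comment> \<open>The entry \<open>(i0, i0)\<close> of \<open>Q\<close>.\<close>
  define A where "A = [:of_real \<eta>:] + smult (of_real c) (monom 1 k * p i0 i0)"
  have "poly A 0 \<noteq> 0" using \<eta> by (simp add: A_def poly_monom k_def)
  hence "A \<noteq> 0" by auto
  hence "finite {a. poly A a = 0}" by (rule poly_roots_finite)
  hence "finite ((\<lambda>a. - (of_real c * (a ^ k * poly (p i0 j0) a)) / (of_real \<eta> * a ^ (n - 1))) ` {a. poly A a = 0})" (is "finite ?bad")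
    by (rule finite_imageI)
  \<comment> \<open>The excluded values are those for which the entry \<open>(i0, j0)\<close> vanishes at a root of \<open>A\<close>.\<close>
  then obtain u where u: "u \<in> circle" "u \<notin> ?bad"
    using infinite_circle by (meson finite_subset subsetI)
  define R where "R a b = (if a = b then [:of_real \<eta>:] else 0) + smult (of_real c) (monom 1 k * p a b)
     + (if b = swap a then monom (of_real \<eta> * u) (n - 1) else 0)" for a b
  have kN: "k + N < n - 1" using n by (simp add: k_def)
  have dmid: "degree (smult (of_real c) (monom 1 k * p a b)) \<le> k + N" for a b
  proof -
    have "degree (smult (of_real c) (monom 1 k * p a b)) \<le> degree (monom (1::complex) k) + degree (p a b)"
      using degree_smult_le degree_mult_le order_trans by blast
    also have "\<dots> \<le> k + N" by (intro add_mono degree_monom_le p)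
    finally show ?thesis .
  qed
  have dR: "degree (R a b) < n" for a b
  proof -
    have "degree (R a b) \<le> n - 1" unfolding R_def
      by (intro degree_add_le order_trans[OF dmid]) (use kN in \<open>auto intro: degree_monom_le\<close>)
    thus ?thesis using n by simp
  qed
  define V where "V = coeff_mat n R"
  have Q: "Q_fun n V z = (\<chi> a b. poly (R a b) z)" for z
    unfolding V_def by (rule Q_fun_coeff_mat[OF dR])
  have "V 1 $ i0 $ j0 = of_real \<eta> * u"
  proof -
    have "coeff (smult (of_real c) (monom 1 k * p i0 j0)) (n - 1) = 0"
      using dmid[of i0 j0] kN by (intro coeff_eq_0) simp
    thus ?thesis using ij by (simp add: V_def coeff_mat_def R_def swap_def)
  qed
  hence V1: "V 1 \<noteq> 0" using u \<eta> by auto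
  have reg: "regular n V"
    unfolding regular_def
  proof (intro allI impI)
    fix a assume "Q_fun n V a = 0"
    hence 0: "poly (R i j) a = 0" for i j by (simp add: Q vec_eq_iff)
    have "R i0 i0 = A" using ij by (simp add: R_def A_def swap_def)
    hence Aa: "poly A a = 0" using 0[of i0 i0] by simp
    hence "a \<noteq> 0" using \<open>poly A 0 \<noteq> 0\<close> by auto
    have "of_real c * (a ^ k * poly (p i0 j0) a) + of_real \<eta> * u * a ^ (n - 1) = 0"
      using 0[of i0 j0] ij by (simp add: R_def swap_def poly_monom)
    hence "u = - (of_real c * (a ^ k * poly (p i0 j0) a)) / (of_real \<eta> * a ^ (n - 1))"
    proof (subst nonzero_eq_divide_eq)
      show "of_real \<eta> * a ^ (n - 1) \<noteq> 0" using \<open>a \<noteq> 0\<close> \<eta> by simp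
    qed (simp add: eq_neg_iff_add_eq_0 mult_ac add.commute)
    thus "a \<in> circle" using u(2) Aa by blast
  qed
  define B where "B t = (if t = 0 then (\<lambda>z. cscale (of_real \<eta>) (mat 1)) else if t = 1 then (\<lambda>z. cscale (of_real c) (P z))
     else (\<lambda>z. cscale (of_real \<eta> * u) U))" for t :: nat
  define e where "e t = (if t = 0 then 0 else if t = 1 then k else n - 1)" for t :: nat
  have B: "poly_mat N (B t)" for t
    by (auto simp: B_def intro!: poly_mat_cscale poly_mat_const P(1))
  have QB: "Q_fun n V = (\<lambda>z. \<Sum>t<3. cscale (z ^ e t) (B t z))"
  proof (rule ext)
    fix z
    have "Q_fun n V z = cscale (of_real \<eta>) (mat 1) + cscale (z ^ k) (cscale (of_real c) (P z)) + cscale (z ^ (n - 1)) (cscale (of_real \<eta> * u) U)"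
      unfolding mat_eq_iff by (auto simp: Q R_def p(2) poly_monom mat_def U_def)
    thus "Q_fun n V z = (\<Sum>t<3. cscale (z ^ e t) (B t z))"
      by (simp add: B_def e_def eval_nat_numeral)
  qed
  have SQ: "sandwich (Q_fun n V) G = cscale (of_real (\<eta>\<^sup>2)) (sandwich (\<lambda>z. mat 1) G) + cscale (of_real (1 - 2 * \<eta>\<^sup>2)) (sandwich P G)
     + cscale (of_real (\<eta>\<^sup>2)) (sandwich (\<lambda>z. U) G)" if G: "trig_mat M G" for G
  proof -
    have "sandwich (Q_fun n V) G = (\<Sum>t<3. sandwich (B t) G)"
      unfolding QB
    proof (rule sandwich_blocks[OF finite_lessThan B G])
      fix s t :: nat assume "s \<in> {..<3}" "t \<in> {..<3}" "s \<noteq> t"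
      hence "s = 0 \<or> s = 1 \<or> s = 2" "t = 0 \<or> t = 1 \<or> t = 2" by auto
      moreover have "e 0 = 0" "e 1 = k" "e 2 = n - 1" by (simp_all add: e_def)
      moreover have "M + N < k" "k + (M + N) < n - 1" using n by (simp_all add: k_def)
      ultimately show "int (M + N) < \<bar>int (e t) - int (e s)\<bar>"
        using \<open>s \<noteq> t\<close> by (elim disjE) simp_all
    qed
    also have "\<dots> = sandwich (B 0) G + sandwich (B 1) G + sandwich (B 2) G"
      by (simp add: eval_nat_numeral)
    also have "sandwich (B 0) G = cscale (of_real (\<eta>\<^sup>2)) (sandwich (\<lambda>z. mat 1) G)"
      using sandwich_cscale_arg[OF continuous_on_const trig_mat_continuous[OF G], of "of_real \<eta>" "mat 1"]
      by (simp add: B_def)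
    also have "sandwich (B 1) G = cscale (of_real (1 - 2 * \<eta>\<^sup>2)) (sandwich P G)"
      using sandwich_cscale_arg[OF poly_mat_continuous[OF P(1)] trig_mat_continuous[OF G], of "of_real c"] c2
      by (simp add: B_def)
    also have "sandwich (B 2) G = cscale (of_real (\<eta>\<^sup>2)) (sandwich (\<lambda>z. U) G)"
      using sandwich_cscale_arg[OF continuous_on_const trig_mat_continuous[OF G], of "of_real \<eta> * u" U] u(1) \<eta>
      by (simp add: B_def norm_mult)
    finally show ?thesis .
  qed
  have one: "sandwich (Q_fun n V) (\<lambda>z. mat 1) = mat 1"
    unfolding SQ[OF trig_mat_const] sandwich_const P(2) U adj_mat_1 matrix_mul_lid
    by (simp add: mat_eq_iff algebra_simps)
  show ?thesis
  proof (intro exI[of _ V] conjI allI impI)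
    show "Phi n V \<in> B_maps n" using n by (intro Phi_in_B_maps one reg V1) simp
    fix G :: "complex \<Rightarrow> 'm cmat" assume G: "trig_mat M G" "\<forall>z\<in>circle. opnorm (G z) \<le> 1"
    note Gc = trig_mat_continuous[OF G(1)]
    have le: "opnorm (sandwich W G) \<le> 1" if "poly_mat N W" "sandwich W (\<lambda>z. mat 1) = mat 1" for W
      by (rule opnorm_sandwich_le[OF that Gc]) (use G in blast)
    let ?S1 = "sandwich (\<lambda>z. mat 1) G" and ?SP = "sandwich P G" and ?SU = "sandwich (\<lambda>z. U) G"
    have "sandwich P G - Phi n V G = cscale (of_real (\<eta>\<^sup>2)) ((?SP - ?S1) + (?SP - ?SU))"
      unfolding Phi_eq_sandwich[OF Gc] SQ[OF G(1)] by (simp add: mat_eq_iff algebra_simps)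
    also have "opnorm \<dots> \<le> \<eta>\<^sup>2 * opnorm ((?SP - ?S1) + (?SP - ?SU))"
      using opnorm_cscale_le[of "of_real (\<eta>\<^sup>2)"] by (simp add: norm_power)
    also have "\<dots> \<le> \<eta>\<^sup>2 * 4"
    proof (rule mult_left_mono)
      have tri: "opnorm (X - Y) \<le> opnorm X + opnorm Y" for X Y :: "'m cmat"
        using opnorm_triangle[of X "- Y"] opnorm_minus[of 0 Y] by simp
      have "adj (mat 1) ** mat 1 = (mat 1 :: 'm cmat)" by (simp add: adj_mat_1)
      hence "opnorm ?S1 \<le> 1" by (intro le poly_mat_const) (simp add: sandwich_const)
      moreover have "opnorm ?SP \<le> 1" by (intro le P)
      moreover have "opnorm ?SU \<le> 1" by (intro le poly_mat_const) (simp add: sandwich_const U)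
      ultimately show "opnorm ((?SP - ?S1) + (?SP - ?SU)) \<le> 4"
        using opnorm_triangle[of "?SP - ?S1" "?SP - ?SU"] tri[of ?SP ?S1] tri[of ?SP ?SU] by linarith
    qed simp
    finally show "opnorm (sandwich P G - Phi n V G) \<le> 4 * \<eta>\<^sup>2" by simp
  qed
qed

subsection \<open>Scalar polynomials\<close>

text \<open>Reflecting a root \<open>a\<close> in the circle, that is, replacing the factor \<open>z - a\<close> by \<open>1 - cnj a z\<close>, does not
  change the modulus on the circle. Move all roots outside the open disc to get \<open>p\<close>, and into the
  closed disc to get \<open>p'\<close>; the comparison of \<open>p\<close> with \<open>p'\<close> off the circle holds factor by factor.\<close>

lemma reflect_roots:
  fixes q :: "complex poly"
  assumes "q \<noteq> 0"
  shows "\<exists>p p'. degree p \<le> degree q \<and> degree p' = degree q \<and>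
    (\<forall>z. cmod z = 1 \<longrightarrow> cmod (poly p z) = cmod (poly q z) \<and> cmod (poly p' z) = cmod (poly q z)) \<and>
    (\<forall>z. cmod z < 1 \<longrightarrow> poly p z \<noteq> 0 \<and> cmod (poly p' z) \<le> cmod (poly p z)) \<and>
    (\<forall>z. 1 < cmod z \<longrightarrow> poly p' z \<noteq> 0 \<and> cmod (poly p z) \<le> cmod (poly p' z))"
  using assms
proof (induction "degree q" arbitrary: q)
  case 0
  then obtain c where "q = [:c:]" using degree_eq_zeroE by metis
  thus ?case using 0 by (intro exI[of _ q]) auto
next
  case (Suc d)
  from Suc.hyps(2) have "\<not> constant (poly q)" by (simp add: constant_degree)
  then obtain a where "poly q a = 0" using fundamental_theorem_of_algebra by blast
  then obtain r where r: "q = [:- a, 1:] * r" by (auto simp: poly_eq_0_iff_dvd)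
  hence "r \<noteq> 0" using Suc.prems by auto
  hence dr: "d = degree r" "degree q = Suc (degree r)" using Suc.hyps(2) by (simp_all add: r degree_mult_eq del: mult_pCons_left)
  obtain p p' where p: "degree p \<le> degree r" "degree p' = degree r"
    "\<And>z. cmod z = 1 \<Longrightarrow> cmod (poly p z) = cmod (poly r z) \<and> cmod (poly p' z) = cmod (poly r z)"
    "\<And>z. cmod z < 1 \<Longrightarrow> poly p z \<noteq> 0 \<and> cmod (poly p' z) \<le> cmod (poly p z)"
    "\<And>z. 1 < cmod z \<Longrightarrow> poly p' z \<noteq> 0 \<and> cmod (poly p z) \<le> cmod (poly p' z)"
    using Suc.hyps(1)[OF dr(1) \<open>r \<noteq> 0\<close>] by blast
  have "p' \<noteq> 0" using p(5)[of 2] by auto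
  have ev1: "poly ([:- a, 1:] * s) z = (z - a) * poly s z"
    and ev2: "poly ([:1, - cnj a:] * s) z = (1 - cnj a * z) * poly s z" for s z
    by (simp_all add: algebra_simps)
  have id: "(cmod (1 - cnj a * z))\<^sup>2 - (cmod (z - a))\<^sup>2 = (1 - (cmod z)\<^sup>2) * (1 - (cmod a)\<^sup>2)" for z
    unfolding cmod_power2 by (simp add: algebra_simps power2_eq_square)
  have le1: "cmod (1 - cnj a * z) \<le> cmod (z - a)" if "0 \<le> (1 - (cmod z)\<^sup>2) * ((cmod a)\<^sup>2 - 1)" for z
  proof (rule power2_le_imp_le)
    have "(1 - (cmod z)\<^sup>2) * (1 - (cmod a)\<^sup>2) = - ((1 - (cmod z)\<^sup>2) * ((cmod a)\<^sup>2 - 1))"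
      by (simp add: algebra_simps)
    thus "(cmod (1 - cnj a * z))\<^sup>2 \<le> (cmod (z - a))\<^sup>2" using id[of z] that by linarith
  qed simp
  have le2: "cmod (z - a) \<le> cmod (1 - cnj a * z)" if "0 \<le> (1 - (cmod z)\<^sup>2) * (1 - (cmod a)\<^sup>2)" for z
  proof (rule power2_le_imp_le)
    show "(cmod (z - a))\<^sup>2 \<le> (cmod (1 - cnj a * z))\<^sup>2" using id[of z] that by linarith
  qed simp
  have eq: "cmod (1 - cnj a * z) = cmod (z - a)" if "cmod z = 1" for z
    using le1[of z] le2[of z] that by simp
  have nz: "1 - cnj a * z \<noteq> 0" if "cmod a * cmod z \<noteq> 1" for z
    using that by (metis complex_mod_cnj eq_iff_diff_eq_0 norm_mult norm_one)
  have sq: "x\<^sup>2 \<le> 1" if "0 \<le> x" "x \<le> 1" for x :: real using that by (simp add: power_le_one)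
  have sq': "1 \<le> x\<^sup>2" if "1 \<le> x" for x :: real using that by simp
  show ?case
  proof (cases "1 \<le> cmod a")
    case True
    let ?p = "[:- a, 1:] * p" and ?p' = "[:1, - cnj a:] * p'"
    have "a \<noteq> 0" using True by auto
    have "degree ?p \<le> degree q" using p(1) dr degree_mult_le[of "[:- a, 1:]" p] by (simp del: mult_pCons_left)
    moreover have "degree ?p' = degree q"
      using p(2) dr \<open>p' \<noteq> 0\<close> \<open>a \<noteq> 0\<close> by (subst degree_mult_eq) auto
    moreover have "cmod (poly ?p z) = cmod (poly q z) \<and> cmod (poly ?p' z) = cmod (poly q z)" if "cmod z = 1" for z
      using p(3)[OF that] eq[OF that] unfolding r ev1 ev2 norm_mult by simp
    moreover have "poly ?p z \<noteq> 0 \<and> cmod (poly ?p' z) \<le> cmod (poly ?p z)" if z: "cmod z < 1" for z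
    proof -
      have "cmod (1 - cnj a * z) \<le> cmod (z - a)"
        using True z by (intro le1 mult_nonneg_nonneg) (auto simp: sq sq')
      moreover have "z \<noteq> a" using True z by auto
      ultimately show ?thesis using p(4)[OF z] unfolding ev1 ev2 norm_mult
        by (auto intro!: mult_mono)
    qed
    moreover have "poly ?p' z \<noteq> 0 \<and> cmod (poly ?p z) \<le> cmod (poly ?p' z)" if z: "1 < cmod z" for z
    proof -
      have "cmod (z - a) \<le> cmod (1 - cnj a * z)"
        using True z by (intro le2 mult_nonpos_nonpos) (auto simp: sq sq')
      moreover have "1 * cmod z \<le> cmod a * cmod z" using True by (intro mult_right_mono) auto
      hence "1 - cnj a * z \<noteq> 0" using z by (intro nz) auto
      ultimately show ?thesis using p(5)[OF z] unfolding ev1 ev2 norm_mult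
        by (auto intro!: mult_mono)
    qed
    ultimately show ?thesis by blast
  next
    case False
    let ?p = "[:1, - cnj a:] * p" and ?p' = "[:- a, 1:] * p'"
    have "degree ?p \<le> degree q" using p(1) dr degree_mult_le[of "[:1, - cnj a:]" p] by (simp del: mult_pCons_left split: if_splits)
    moreover have "degree ?p' = degree q"
      using p(2) dr \<open>p' \<noteq> 0\<close> by (subst degree_mult_eq) auto
    moreover have "cmod (poly ?p z) = cmod (poly q z) \<and> cmod (poly ?p' z) = cmod (poly q z)" if "cmod z = 1" for z
      using p(3)[OF that] eq[OF that] unfolding r ev1 ev2 norm_mult by simp
    moreover have "poly ?p z \<noteq> 0 \<and> cmod (poly ?p' z) \<le> cmod (poly ?p z)" if z: "cmod z < 1" for z
    proof -
      have "cmod (z - a) \<le> cmod (1 - cnj a * z)"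
        using False z by (intro le2 mult_nonneg_nonneg) (auto simp: sq sq')
      moreover have "cmod a * cmod z \<le> 1 * cmod z" using False by (intro mult_right_mono) auto
      hence "1 - cnj a * z \<noteq> 0" using z by (intro nz) auto
      ultimately show ?thesis using p(4)[OF z] unfolding ev1 ev2 norm_mult
        by (auto intro!: mult_mono)
    qed
    moreover have "poly ?p' z \<noteq> 0 \<and> cmod (poly ?p z) \<le> cmod (poly ?p' z)" if z: "1 < cmod z" for z
    proof -
      have "cmod (1 - cnj a * z) \<le> cmod (z - a)"
        using False z by (intro le1 mult_nonpos_nonpos) (auto simp: sq sq')
      moreover have "z \<noteq> a" using False z by auto
      ultimately show ?thesis using p(5)[OF z] unfolding ev1 ev2 norm_mult
        by (auto intro!: mult_mono)
    qed
    ultimately show ?thesis by blast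
  qed
qed


text \<open>Reflection of roots gives polynomials \<open>f\<close>, \<open>g\<close> with the same modulus as the entry \<open>q\<close> of \<open>P\<close> on
  the circle, such that \<open>\<bar>z\<^sup>k g\<bar> < \<bar>f\<bar>\<close> inside the disc and \<open>\<bar>z\<^sup>k g\<bar> > \<bar>f\<bar>\<close> outside. So \<open>f + z\<^sup>k g\<close> has all its
  roots on the circle. For large \<open>k\<close> the two summands do not interact, and each contributes the
  same as \<open>q\<close> because scalars commute; the factor \<open>1 / sqrt 2\<close> restores the normalisation.\<close>

lemma regular_approx_scalar:
  fixes P :: "complex \<Rightarrow> 'm::finite cmat"
  assumes P: "poly_mat N P" "sandwich P (\<lambda>z. mat 1) = mat 1"
    and n: "M + 2 * N + 2 \<le> n" and one: "\<And>a. a = (i0 :: 'm)"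
  shows "\<exists>V. Phi n V \<in> B_maps n \<and> (\<forall>G. trig_mat M G \<longrightarrow> Phi n V G = sandwich P G)"
proof -
  have UN: "(UNIV :: 'm set) = {i0}" using one by auto
  obtain p where p: "\<And>a b. degree (p a b) \<le> N" "\<And>z a b. P z $ a $ b = poly (p a b) z"
    using poly_mat_polys[OF P(1)] by blast
  define q where "q = p i0 i0"
  have Pq: "P z $ a $ b = poly q z" for z a b using one[of a] one[of b] by (simp add: q_def p)
  have "q \<noteq> 0"
  proof
    assume "q = 0"
    hence "P = (\<lambda>z. 0)" by (intro ext) (simp add: mat_eq_iff Pq)
    hence "sandwich P (\<lambda>z. mat 1) = 0" by (simp add: sandwich_def)
    hence "(mat 1 :: 'm cmat) $ i0 $ i0 = 0" using P(2) by simp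
    thus False by (simp add: mat_def)
  qed
  from reflect_roots[OF this] obtain f g where fg: "degree f \<le> degree q" "degree g = degree q"
    "\<And>z. cmod z = 1 \<Longrightarrow> cmod (poly f z) = cmod (poly q z)" "\<And>z. cmod z = 1 \<Longrightarrow> cmod (poly g z) = cmod (poly q z)"
    "\<And>z. cmod z < 1 \<Longrightarrow> poly f z \<noteq> 0 \<and> cmod (poly g z) \<le> cmod (poly f z)"
    "\<And>z. 1 < cmod z \<Longrightarrow> poly g z \<noteq> 0 \<and> cmod (poly f z) \<le> cmod (poly g z)"
    by blast
  have dq: "degree q \<le> N" by (simp add: q_def p)
  define k where "k = n - 1 - degree q"
  have k: "M + N < k" "k + degree q = n - 1" "0 < k" using n dq by (auto simp: k_def)
  have "g \<noteq> 0" using fg(6)[of 2] by auto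
  define s where "s = complex_of_real (1 / sqrt 2)"
  have s: "s \<noteq> 0" "(cmod s)\<^sup>2 = 1 / 2" by (simp_all add: s_def norm_divide power_divide)
  define h where "h = smult s (f + monom 1 k * g)"
  have dg: "degree (monom 1 k * g) = n - 1"
    using \<open>g \<noteq> 0\<close> fg(2) k(2) by (subst degree_mult_eq) (auto simp: degree_monom_eq)
  have "degree h \<le> n - 1" unfolding h_def
    using fg(1) k dg by (intro order_trans[OF degree_smult_le] degree_add_le) auto
  hence dh: "degree h < n" using n by simp
  define V :: "nat \<Rightarrow> 'm cmat" where "V = coeff_mat n (\<lambda>a b. h)"
  have Q: "Q_fun n V z = (\<chi> a b. poly h z)" for z
    unfolding V_def by (rule Q_fun_coeff_mat[OF dh])
  have "coeff f (n - 1) = 0" using fg(1) k by (intro coeff_eq_0) simp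
  moreover have "coeff (monom 1 k * g) (n - 1) \<noteq> 0" using dg \<open>g \<noteq> 0\<close>
    by (metis leading_coeff_0_iff monom_eq_0_iff mult_eq_0_iff zero_neq_one)
  ultimately have "V 1 $ i0 $ i0 \<noteq> 0" using s by (simp add: V_def coeff_mat_def h_def)
  hence V1: "V 1 \<noteq> 0" by auto
  have reg: "regular n V"
    unfolding regular_def
  proof (intro allI impI)
    fix a assume "Q_fun n V a = 0"
    hence "poly h a = 0" by (simp add: Q vec_eq_iff)
    hence "poly f a = - (a ^ k * poly g a)" using s(1) by (simp add: h_def poly_monom eq_neg_iff_add_eq_0)
    hence eq: "cmod (poly f a) = cmod a ^ k * cmod (poly g a)" by (simp add: norm_mult norm_power)
    show "a \<in> circle"
    proof (rule ccontr)
      assume "a \<notin> circle"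
      hence "cmod a \<noteq> 1" by simp
      then consider "cmod a < 1" | "1 < cmod a" by linarith
      thus False
      proof cases
        case 1
        have "cmod a ^ k * cmod (poly g a) \<le> cmod a ^ k * cmod (poly f a)"
          using fg(5)[OF 1] by (intro mult_left_mono) auto
        also have "\<dots> < 1 * cmod (poly f a)"
          using fg(5)[OF 1] 1 k(3) by (intro mult_strict_right_mono power_Suc_less_one) (auto simp: power_less_one_iff)
        finally show False using eq by simp
      next
        case 2
        have "1 * cmod (poly g a) < cmod a ^ k * cmod (poly g a)"
          using fg(6)[OF 2] 2 k(3) by (intro mult_strict_right_mono one_less_power) auto
        thus False using eq conjunct2[OF fg(6)[OF 2]] by linarith
      qed
    qed
  qed
  define F where "F t z = (\<chi> a b. poly (if t = (0::nat) then f else g) z :: complex ^ 'm ^ 'm)" for t z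
  define F' where "F' t = (\<lambda>z. cscale s (F t z))" for t
  define e where "e t = (if t = (0::nat) then 0 else k)" for t
  have F: "poly_mat N (F t)" for t
    unfolding poly_mat_def F_def
    using fg(1,2) dq by (intro allI exI[of _ "if t = 0 then f else g"]) auto
  have FP: "sandwich (F t) G = sandwich P G" for t and G :: "complex \<Rightarrow> 'm cmat"
    unfolding sandwich_def
  proof (rule cmean_cong)
    fix z :: complex assume z: "z \<in> circle"
    have "cmod (poly (if t = 0 then f else g) z) = cmod (poly q z)" using z fg(3,4) by auto
    hence c: "cnj (poly (if t = 0 then f else g) z) * poly (if t = 0 then f else g) z = cnj (poly q z) * poly q z"
      using complex_norm_square mult.commute by metis
    have "(adj (F t z) ** G z ** F t z) $ a $ b = (adj (P z) ** G z ** P z) $ a $ b" for a b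
      using arg_cong[OF c, of "\<lambda>x. x * G z $ i0 $ i0"] by (simp add: mm_nth UN F_def Pq mult_ac)
    thus "adj (F t z) ** G z ** F t z = adj (P z) ** G z ** P z" by (simp add: mat_eq_iff)
  qed
  have SQ: "sandwich (Q_fun n V) G = sandwich P G" if G: "trig_mat M G" for G
  proof -
    have QF: "Q_fun n V = (\<lambda>z. \<Sum>t<2. cscale (z ^ e t) (F' t z))"
      by (rule ext) (simp add: mat_eq_iff Q F'_def F_def e_def h_def eval_nat_numeral poly_monom algebra_simps)
    have "sandwich (Q_fun n V) G = (\<Sum>t<2. sandwich (F' t) G)"
      unfolding QF
    proof (rule sandwich_blocks[OF finite_lessThan _ G])
      show "poly_mat N (F' t)" for t unfolding F'_def by (rule poly_mat_cscale[OF F])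
      fix s t :: nat assume "s \<in> {..<2}" "t \<in> {..<2}" "s \<noteq> t"
      thus "int (M + N) < \<bar>int (e t) - int (e s)\<bar>" using k(1) by (auto simp: e_def)
    qed
    also have "\<dots> = (\<Sum>t<2::nat. cscale (of_real (1 / 2)) (sandwich P G))"
    proof (rule sum.cong[OF refl])
      fix t :: nat
      show "sandwich (F' t) G = cscale (of_real (1 / 2)) (sandwich P G)"
        unfolding F'_def sandwich_cscale_arg[OF poly_mat_continuous[OF F] trig_mat_continuous[OF G]] s(2) FP ..
    qed
    also have "\<dots> = sandwich P G" by (simp add: mat_eq_iff)
    finally show ?thesis .
  qed
  have "Phi n V \<in> B_maps n"
    using n SQ[OF trig_mat_const] P(2) by (intro Phi_in_B_maps reg V1) auto
  thus ?thesis using SQ Phi_eq_sandwich trig_mat_continuous by metis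
qed

section \<open>Convergence\<close>

lemma regular_approx:
  fixes P :: "complex \<Rightarrow> 'm::finite cmat"
  assumes P: "poly_mat N P" "sandwich P (\<lambda>z. mat 1) = mat 1"
    and \<eta>: "0 < \<eta>" "\<eta> \<le> 1 / 2" and n: "2 * (M + N) + 4 \<le> n"
  shows "\<exists>V. Phi n V \<in> B_maps n \<and> (\<forall>G. trig_mat M G \<longrightarrow> (\<forall>z\<in>circle. opnorm (G z) \<le> 1) \<longrightarrow>
    opnorm (sandwich P G - Phi n V G) \<le> 4 * \<eta>\<^sup>2)"
proof (cases "\<exists>i0 j0 :: 'm. i0 \<noteq> j0")
  case True
  thus ?thesis using regular_approx_matrix[OF P \<eta> n] by blast
next
  case False
  hence one: "a = undefined" for a :: 'm by blast
  have "M + 2 * N + 2 \<le> n" using n by simp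
  from regular_approx_scalar[OF P this one] obtain V where V: "Phi n V \<in> B_maps n"
    "\<And>G. trig_mat M G \<Longrightarrow> Phi n V G = sandwich P G" by blast
  thus ?thesis by (intro exI[of _ V]) simp
qed

lemma ucp_close:
  assumes \<phi>: "\<phi> \<in> ucp" and \<psi>: "\<psi> \<in> ucp" and f: "f \<in> test_functions"
  shows "opnorm (\<phi> f - \<psi> f :: 'm::finite cmat) \<le> 2"
proof -
  have le: "opnorm (\<omega> f) \<le> 1" if "\<omega> \<in> ucp" for \<omega> :: "(complex \<Rightarrow> 'm cmat) \<Rightarrow> 'm cmat"
    by (rule ucp_contractive[OF that test_function_continuous[OF f] _ test_function_le_1[OF f]]) simp_all
  show ?thesis
    using opnorm_triangle[of "\<phi> f" "- \<psi> f"] opnorm_minus[of 0 "\<psi> f"] le[OF \<phi>] le[OF \<psi>] by simp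
qed

lemma zero_test_function: "(\<lambda>z. 0) \<in> test_functions"
  by (simp add: test_functions_def C1_circle_def angular_deriv_def sup_norm_def)

lemma rho_le:
  assumes "\<And>f. f \<in> test_functions \<Longrightarrow> opnorm (\<phi> f - \<psi> f) \<le> e"
  shows "rho \<phi> \<psi> \<le> e"
  unfolding rho_def using zero_test_function assms by (intro cSUP_least) auto

lemma rho_nonneg:
  assumes "\<phi> \<in> ucp" "\<psi> \<in> ucp"
  shows "0 \<le> rho \<phi> \<psi>"
proof -
  have "bdd_above ((\<lambda>f. opnorm (\<phi> f - \<psi> f)) ` test_functions)"
    using ucp_close[OF assms] by (intro bdd_aboveI2)
  from cSUP_upper[OF zero_test_function this] show ?thesis
    unfolding rho_def using opnorm_nonneg order_trans by blast
qed

lemma ucp_nonempty: "(ucp :: ((complex \<Rightarrow> 'm::finite cmat) \<Rightarrow> 'm cmat) set) \<noteq> {}"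
proof -
  have "sandwich (Q_fun 1 (\<lambda>_. mat 1)) (\<lambda>z. mat 1) = (mat 1 :: 'm cmat)"
    unfolding sandwich_Q_fun_one by (simp add: adj_mat_1)
  from Phi_ucp[OF this] show ?thesis by blast
qed

text \<open>The three errors are those of \<open>ucp_approx\<close> (\<open>27 rad M\<close>), of the regularisation (\<open>4 \<eta>\<^sup>2\<close>), and of smoothing
  under the contractive map \<open>Phi n V\<close> (\<open>9 rad M\<close>).\<close>

lemma uniform_approx:
  assumes "0 < \<epsilon>"
  shows "\<exists>N. \<forall>n\<ge>N. \<forall>\<phi>\<in>ucp. \<exists>\<psi>\<in>B_maps n. rho \<phi> (\<psi> :: (complex \<Rightarrow> 'm::finite cmat) \<Rightarrow> 'm cmat) \<le> \<epsilon>"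
proof -
  obtain M :: nat where M: "(72 / \<epsilon>)\<^sup>2 < real M" using reals_Archimedean2 by blast
  have "36 * rad M \<le> \<epsilon> / 2"
  proof -
    have "72 / \<epsilon> = sqrt ((72 / \<epsilon>)\<^sup>2)" using assms by simp
    also have "\<dots> \<le> sqrt (real M + 1)" using M by (intro real_sqrt_le_mono) simp
    finally have "72 \<le> sqrt (real M + 1) * \<epsilon>" using assms by (simp add: divide_le_eq)
    thus ?thesis by (simp add: rad_def divide_le_eq mult.commute)
  qed
  define \<eta> where "\<eta> = min (1 / 2) (\<epsilon> / 4)"
  have \<eta>: "0 < \<eta>" "\<eta> \<le> 1 / 2" "\<eta> \<le> \<epsilon> / 4" using assms by (auto simp: \<eta>_def)
  have "\<eta>\<^sup>2 \<le> (1 / 2) * (\<epsilon> / 4)" unfolding power2_eq_square using \<eta> by (intro mult_mono) auto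
  obtain N where N: "\<And>\<phi>. \<phi> \<in> ucp \<Longrightarrow> \<exists>P. poly_mat N P \<and> sandwich P (\<lambda>z. mat 1) = mat 1 \<and>
    (\<forall>f\<in>test_functions. opnorm (\<phi> f - sandwich P (smooth M f) :: 'm cmat) \<le> 27 * rad M)"
    using ucp_approx[of M, where 'm = 'm] by blast
  show ?thesis
  proof (intro exI[of _ "2 * (M + N) + 4"] allI impI ballI)
    fix n and \<phi> :: "(complex \<Rightarrow> 'm cmat) \<Rightarrow> 'm cmat" assume n: "2 * (M + N) + 4 \<le> n" and \<phi>: "\<phi> \<in> ucp"
    from N[OF \<phi>] obtain P where P: "poly_mat N P" "sandwich P (\<lambda>z. mat 1) = mat 1"
      "\<And>f. f \<in> test_functions \<Longrightarrow> opnorm (\<phi> f - sandwich P (smooth M f)) \<le> 27 * rad M" by blast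
    from regular_approx[OF P(1,2) \<eta>(1,2) n] obtain V where V: "Phi n V \<in> B_maps n"
      "\<And>G. trig_mat M G \<Longrightarrow> (\<And>z. z \<in> circle \<Longrightarrow> opnorm (G z) \<le> 1) \<Longrightarrow> opnorm (sandwich P G - Phi n V G) \<le> 4 * \<eta>\<^sup>2"
      by blast
    from V(1) have u: "Phi n V \<in> ucp" by (auto simp: B_maps_def)
    have "rho \<phi> (Phi n V) \<le> \<epsilon>"
    proof (rule rho_le)
      fix f :: "complex \<Rightarrow> 'm cmat" assume f: "f \<in> test_functions"
      let ?T = "smooth M f"
      have Tc: "continuous_on circle ?T" by (rule trig_mat_continuous[OF trig_mat_smooth])
      have 1: "opnorm (\<phi> f - sandwich P ?T) \<le> 27 * rad M" by (rule P(3)[OF f])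
      have 2: "opnorm (sandwich P ?T - Phi n V ?T) \<le> 4 * \<eta>\<^sup>2"
        by (rule V(2)[OF trig_mat_smooth smooth_le_1[OF f]])
      have "opnorm (Phi n V (\<lambda>z. f z - ?T z)) \<le> 9 * rad M"
        by (rule ucp_contractive[OF u continuous_on_diff[OF test_function_continuous[OF f] Tc] _ smooth_approx[OF f]])
           (simp add: rad_pos)
      hence 3: "opnorm (Phi n V ?T - Phi n V f) \<le> 9 * rad M"
        unfolding ucp_diff[OF u test_function_continuous[OF f] Tc] by (simp add: opnorm_minus)
      have "opnorm (\<phi> f - Phi n V f) \<le> opnorm (\<phi> f - sandwich P ?T) + (opnorm (sandwich P ?T - Phi n V ?T) + opnorm (Phi n V ?T - Phi n V f))"
        using opnorm_triangle[of "\<phi> f - sandwich P ?T" "sandwich P ?T - Phi n V f"]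
          opnorm_triangle[of "sandwich P ?T - Phi n V ?T" "Phi n V ?T - Phi n V f"] by simp
      also have "\<dots> \<le> \<epsilon>"
        using 1 2 3 \<open>36 * rad M \<le> \<epsilon> / 2\<close> \<open>\<eta>\<^sup>2 \<le> (1 / 2) * (\<epsilon> / 4)\<close> by linarith
      finally show "opnorm (\<phi> f - Phi n V f) \<le> \<epsilon>" .
    qed
    with V(1) show "\<exists>\<psi>\<in>B_maps n. rho \<phi> \<psi> \<le> \<epsilon>" by blast
  qed
qed

theorem theorem3:
  shows "(\<lambda>n. hausdorff_dist rho
            (B_maps n :: ((complex \<Rightarrow> complex ^ 'm::finite ^ 'm) \<Rightarrow> complex ^ 'm ^ 'm) set) ucp)
         \<longlonglongrightarrow> 0"
proof (rule LIMSEQ_I)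
  fix r :: real assume "0 < r"
  hence "0 < r / 2" by simp
  from uniform_approx[OF this, where 'm = 'm] obtain N where
    N: "\<And>n \<phi>. N \<le> n \<Longrightarrow> \<phi> \<in> ucp \<Longrightarrow> \<exists>\<psi>\<in>B_maps n. rho \<phi> (\<psi> :: (complex \<Rightarrow> 'm cmat) \<Rightarrow> 'm cmat) \<le> r / 2"
    by blast
  show "\<exists>no. \<forall>n\<ge>no. norm (hausdorff_dist rho (B_maps n :: ((complex \<Rightarrow> 'm cmat) \<Rightarrow> 'm cmat) set) ucp - 0) < r"
  proof (intro exI[of _ N] allI impI)
    fix n assume n: "N \<le> n"
    let ?B = "B_maps n :: ((complex \<Rightarrow> 'm cmat) \<Rightarrow> 'm cmat) set"
    have sub: "?B \<subseteq> ucp" by (auto simp: B_maps_def)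
    obtain \<phi>0 :: "(complex \<Rightarrow> 'm cmat) \<Rightarrow> 'm cmat" where "\<phi>0 \<in> ucp" using ucp_nonempty by blast
    with N[OF n] have ne: "?B \<noteq> {}" by blast
    \<comment> \<open>Only the supremum over all of \<open>ucp\<close> matters, as \<open>B_maps n\<close> consists of such maps.\<close>
    have "(INF b\<in>ucp. rho a b) = 0" if a: "a \<in> ?B" for a
    proof (rule antisym)
      have bdd: "bdd_below (rho a ` ucp)" using rho_nonneg a sub by (intro bdd_belowI2) blast
      have "(INF b\<in>ucp. rho a b) \<le> rho a a" using a sub by (intro cINF_lower bdd) auto
      also have "rho a a \<le> 0" by (rule rho_le) simp
      finally show "(INF b\<in>ucp. rho a b) \<le> 0" .
      show "0 \<le> (INF b\<in>ucp. rho a b)" using a sub rho_nonneg ucp_nonempty by (intro cINF_greatest) blast+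
    qed
    hence 1: "(SUP a\<in>?B. INF b\<in>ucp. rho a b) = 0" using ne by simp
    have 2: "(SUP b\<in>ucp. INF a\<in>?B. rho b a) \<le> r / 2"
    proof (rule cSUP_least[OF ucp_nonempty])
      fix b :: "(complex \<Rightarrow> 'm cmat) \<Rightarrow> 'm cmat" assume b: "b \<in> ucp"
      from N[OF n b] obtain a where a: "a \<in> ?B" "rho b a \<le> r / 2" by blast
      have "bdd_below (rho b ` ?B)" using rho_nonneg b sub by (intro bdd_belowI2) blast
      from cINF_lower[OF this a(1)] a(2) show "(INF a\<in>?B. rho b a) \<le> r / 2" by (rule order_trans)
    qed
    show "norm (hausdorff_dist rho ?B ucp - 0) < r"
      unfolding hausdorff_dist_def 1 using 2 \<open>0 < r\<close> by auto
  qed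
qed

end
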